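(* Let $0<\alpha\le 0.05$, let $\mathbf{x}\in\mathbb{R}^N$, let $s_{ij}$ ($1\le i\le N$, $1\le j\le M$) be i.i.d. $S(\alpha,1)$, $y_j=\sum_{i=1}^Nx_is_{ij}$, and $\hat x_{i,min}=y_t/s_{it}$ with $t=\arg\min_{1\le j\le M}|y_j/s_{ij}|$. Let $\epsilon>0$, fix a coordinate $i$ with $|x_i|>\epsilon$, and let $\theta_i=\left(\sum_{t\ne i}|x_t|^\alpha\right)^{1/\alpha}>0$. Assume $\left(\frac{|x_i|+\epsilon}{\theta_i}\right)^{\alpha/(1-\alpha)}<1/3$. Then $$\Pr\left(|\hat x_{i,min}|\le\epsilon\right)\le 1-\left[1-\frac34\left|\frac{|x_i|+\epsilon}{\theta_i}\right|^{\frac{\alpha}{1+\alpha}}\left(1-\left|\frac{|x_i|-\epsilon}{|x_i|+\epsilon}\right|^{\alpha/(1-\alpha)}\right)\right]^M.$$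
   Context: A random variable $Z$ has the symmetric $\alpha$-stable distribution with unit scale, $S(\alpha,1)$, if its characteristic function is $E e^{\sqrt{-1}Zt}=e^{-|t|^\alpha}$. *)

theory Defs
  imports "HOL-Probability.Probability"
begin

definition meas :: "(nat \<Rightarrow> real) \<Rightarrow> (nat \<Rightarrow> nat \<Rightarrow> 'a \<Rightarrow> real) \<Rightarrow> nat \<Rightarrow> nat \<Rightarrow> 'a \<Rightarrow> real" where
  "meas x s N j \<omega> = (\<Sum>i=1..N. x i * s i j \<omega>)"

text \<open>Minimum estimator: xhat_{i,min} = y_t / s_{it}, t = argmin_{1<=j<=M} |y_j / s_ij|
  (ties, which occur with probability zero, are broken by arg_min_on).\<close>
definition xhat_min :: "(nat \<Rightarrow> real) \<Rightarrow> (nat \<Rightarrow> nat \<Rightarrow> 'a \<Rightarrow> real) \<Rightarrow> nat \<Rightarrow> nat \<Rightarrow> nat \<Rightarrow> 'a \<Rightarrow> real" where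
  "xhat_min x s N M i \<omega> =
     (let t = arg_min_on (\<lambda>j. \<bar>meas x s N j \<omega> / s i j \<omega>\<bar>) {1..M}
      in meas x s N t \<omega> / s i t \<omega>)"

end

theory Submission
  imports Defs "HOL-Real_Asymp.Real_Asymp"
begin

text \<open>Writing \<open>S = s\<^sub>i\<^sub>j\<close>, we have \<open>y\<^sub>j / S = x\<^sub>i + \<theta> Z / S\<close> with \<open>Z\<close> an independent copy of \<open>S\<close>, so by
  symmetry \<open>Pr (\<bar>y\<^sub>j / S\<bar> \<le> \<epsilon>) = (F b - F a) / 2\<close>, where \<open>F\<close> is the distribution function of
  \<open>\<bar>Z / S\<bar>\<close>, \<open>a = (\<bar>x\<^sub>i\<bar> - \<epsilon>) / \<theta>\<close> and \<open>b = (\<bar>x\<^sub>i\<bar> + \<epsilon>) / \<theta> < 1\<close>.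

  Since \<open>1 - 2 F b = E [sgn (Z - b S) sgn (Z + b S)]\<close>, inserting \<open>sgn y = 2/\<pi> \<integral> sin (u y) / u du\<close> over
  \<open>(0, \<infinity>)\<close> for both factors expresses \<open>F b\<close> as a double integral of characteristic functions, which
  is homogeneous up to the exponent; after rotating the quadrant, the radial integral is a Frullani
  integral. With \<open>T = b\<^sup>\<alpha>\<close> this gives
  \<open>F b = 4 / (\<alpha> \<pi>\<^sup>2) \<integral> ln ((1 + T m\<^sup>-\<^sup>\<alpha>) / (1 + T m\<^sup>\<alpha>)) / (1 - m\<^sup>2) dm\<close> over \<open>(0, 1)\<close>.

  The integrand is concave in \<open>T\<close> and vanishes at \<open>T = 0\<close>, so \<open>F b - F a \<le> F b (1 - (a / b)\<^sup>\<alpha>)\<close>, and it is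
  at most \<open>T (m\<^sup>-\<^sup>\<alpha> - m\<^sup>\<alpha>) / (1 - m\<^sup>2)\<close>, so \<open>F b \<le> b\<^sup>\<alpha> / (1 - \<alpha>\<^sup>2)\<close>. The exponents in the theorem are
  weaker because \<open>b < 1\<close>, and \<open>1 / (2 (1 - \<alpha>\<^sup>2)) \<le> 3 / 4\<close>.\<close>

section \<open>Integrals\<close>

text \<open>The fundamental theorem for nonnegative integrands yields both integrability and the
  value of the Lebesgue integral, so it can be read as a statement about \<open>ennreal\<close>.
  There Tonelli and monotone convergence apply without further integrability checks. The endpoints
  are open and may be infinite because the antiderivatives used below have only limits at 0, 1 or
  infinity.\<close>

lemma nn_integral_FTC_einterval:
  fixes f F :: "real \<Rightarrow> real" and a b :: ereal
  assumes "a < b"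
    and F: "\<And>x. a < ereal x \<Longrightarrow> ereal x < b \<Longrightarrow> DERIV F x :> f x"
    and f: "\<And>x. a < ereal x \<Longrightarrow> ereal x < b \<Longrightarrow> isCont f x"
    and nonneg: "\<And>x. a < ereal x \<Longrightarrow> ereal x < b \<Longrightarrow> 0 \<le> f x"
    and A: "((F \<circ> real_of_ereal) \<longlongrightarrow> A) (at_right a)"
    and B: "((F \<circ> real_of_ereal) \<longlongrightarrow> B) (at_left b)"
  shows "(\<integral>\<^sup>+x. ennreal (f x) * indicator (einterval a b) x \<partial>lborel) = ennreal (B - A)"
proof -
  have nn: "AE x in lborel. a < ereal x \<longrightarrow> ereal x < b \<longrightarrow> 0 \<le> f x"
    using nonneg by auto
  note I = interval_integral_FTC_nonneg[OF \<open>a < b\<close> F f nn A B]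
  have "(\<integral>\<^sup>+x. ennreal (f x) * indicator (einterval a b) x \<partial>lborel) 
      = (\<integral>\<^sup>+x. ennreal (indicator (einterval a b) x *\<^sub>R f x) \<partial>lborel)"
    by (intro nn_integral_cong) (auto split: split_indicator)
  also have "\<dots> = ennreal (\<integral>x. indicator (einterval a b) x *\<^sub>R f x \<partial>lborel)"
    using I(1) nonneg
    by (intro nn_integral_eq_integral) (auto simp: set_integrable_def einterval_def split: split_indicator)
  also have "(\<integral>x. indicator (einterval a b) x *\<^sub>R f x \<partial>lborel) = B - A"
    using I(2) \<open>a < b\<close> by (simp add: interval_lebesgue_integral_def set_lebesgue_integral_def less_imp_le)
  finally show ?thesis .
qed

lemma nn_integral_unit_interval_FTC:
  fixes f F :: "real \<Rightarrow> real"
  assumes F: "\<And>x. 0 < x \<Longrightarrow> x < 1 \<Longrightarrow> DERIV F x :> f x"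
    and f: "\<And>x. 0 < x \<Longrightarrow> x < 1 \<Longrightarrow> isCont f x"
    and nonneg: "\<And>x. 0 < x \<Longrightarrow> x < 1 \<Longrightarrow> 0 \<le> f x"
    and A: "(F \<longlongrightarrow> A) (at_right 0)"
    and B: "(F \<longlongrightarrow> B) (at_left 1)"
  shows "(\<integral>\<^sup>+x. ennreal (f x) * indicator {0<..<1} x \<partial>lborel) = ennreal (B - A)"
proof -
  have 1: "einterval (ereal 0) (ereal 1) = {0<..<1}" by (auto simp: einterval_def)
  show ?thesis
    using nn_integral_FTC_einterval[of "ereal 0" "ereal 1" F f A B] assms
    by (simp add: 1 ereal_tendsto_simps)
qed

lemma nn_integral_half_line_FTC:
  fixes f F :: "real \<Rightarrow> real"
  assumes F: "\<And>x. 0 < x \<Longrightarrow> DERIV F x :> f x"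
    and f: "\<And>x. 0 < x \<Longrightarrow> isCont f x"
    and nonneg: "\<And>x. 0 < x \<Longrightarrow> 0 \<le> f x"
    and A: "(F \<longlongrightarrow> A) (at_right 0)"
    and B: "(F \<longlongrightarrow> B) at_top"
  shows "(\<integral>\<^sup>+x. ennreal (f x) * indicator {0<..} x \<partial>lborel) = ennreal (B - A)"
proof -
  have 1: "einterval (ereal 0) \<infinity> = {0<..}" by (auto simp: einterval_def)
  show ?thesis
    using nn_integral_FTC_einterval[of "ereal 0" "\<infinity>" F f A B] assms
    by (simp add: 1 ereal_tendsto_simps)
qed

lemma nn_integral_stretched_exponential:
  fixes y \<alpha> :: real
  assumes "0 < y" "0 < \<alpha>"
  shows "(\<integral>\<^sup>+p. ennreal (p powr (\<alpha> - 1) * exp (- (y * p powr \<alpha>))) * indicator {0<..} p \<partial>lborel)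
    = ennreal (1 / (\<alpha> * y))"
proof -
  let ?F = "\<lambda>p. - exp (- (y * p powr \<alpha>)) / (\<alpha> * y)"
  have "(\<integral>\<^sup>+p. ennreal (p powr (\<alpha> - 1) * exp (- (y * p powr \<alpha>))) * indicator {0<..} p \<partial>lborel)
    = ennreal (0 - (- 1 / (\<alpha> * y)))"
  proof (rule nn_integral_half_line_FTC[where F = ?F])
    fix p :: real assume "0 < p"
    then show "DERIV ?F p :> p powr (\<alpha> - 1) * exp (- (y * p powr \<alpha>))"
      using assms by (auto intro!: derivative_eq_intros simp: field_simps)
    show "isCont (\<lambda>p. p powr (\<alpha> - 1) * exp (- (y * p powr \<alpha>))) p"
      using \<open>0 < p\<close> by (auto intro!: continuous_intros)
  next
    show "(?F \<longlongrightarrow> - 1 / (\<alpha> * y)) (at_right 0)"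
      using assms by (real_asymp simp: field_simps)
    show "(?F \<longlongrightarrow> 0) at_top"
      using assms by real_asymp
  qed auto
  then show ?thesis by simp
qed

lemma nn_integral_Icc_FTC:
  fixes f F :: "real \<Rightarrow> real"
  assumes "f \<in> borel_measurable borel" "a \<le> b"
    and "\<And>x. x \<in> {a..b} \<Longrightarrow> DERIV F x :> f x"
    and "\<And>x. x \<in> {a..b} \<Longrightarrow> 0 \<le> f x"
  shows "(\<integral>\<^sup>+x. ennreal (f x) * indicator {a..b} x \<partial>lborel) = ennreal (F b - F a)"
  using nn_integral_FTC_Icc[OF assms(1), of a b F] assms
  by (auto intro: has_field_derivative_at_within)

text \<open>The quotient is the integral over \<open>y\<close> in \<open>{A..B}\<close> of
  \<open>p powr (\<alpha> - 1) * exp (- (y * p powr \<alpha>))\<close>. By Tonelli the integral over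
  \<open>p\<close> comes first and leaves \<open>1 / (\<alpha> * y)\<close>, whose integral over
  \<open>{A..B}\<close> is the logarithm.\<close>

lemma frullani_stretched_exponential:
  fixes A B \<alpha> :: real
  assumes "0 < A" "A \<le> B" "0 < \<alpha>"
  shows "(\<integral>\<^sup>+p. ennreal ((exp (- (A * p powr \<alpha>)) - exp (- (B * p powr \<alpha>))) / p) * indicator {0<..} p \<partial>lborel)
    = ennreal (ln (B / A) / \<alpha>)"
proof -
  let ?g = "\<lambda>p y. ennreal (p powr (\<alpha> - 1) * exp (- (y * p powr \<alpha>))) * indicator {0<..} p * indicator {A..B} y :: ennreal"
  have inner: "ennreal ((exp (- (A * p powr \<alpha>)) - exp (- (B * p powr \<alpha>))) / p) * indicator {0<..} p
      = (\<integral>\<^sup>+y. ?g p y \<partial>lborel)" for p :: real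
  proof (cases "0 < p")
    case True
    have "(\<integral>\<^sup>+y. ennreal (p powr (\<alpha> - 1) * exp (- (y * p powr \<alpha>))) * indicator {A..B} y \<partial>lborel)
      = ennreal (- exp (- (B * p powr \<alpha>)) / p - - exp (- (A * p powr \<alpha>)) / p)"
    proof (rule nn_integral_Icc_FTC)
      fix y assume "y \<in> {A..B}"
      show "((\<lambda>y. - exp (- (y * p powr \<alpha>)) / p) has_real_derivative p powr (\<alpha> - 1) * exp (- (y * p powr \<alpha>))) (at y)"
        using True by (auto intro!: derivative_eq_intros simp: powr_diff)
    qed (use assms in auto)
    then show ?thesis
      using True by (simp add: field_simps)
  qed auto
  have "(\<integral>\<^sup>+p. ennreal ((exp (- (A * p powr \<alpha>)) - exp (- (B * p powr \<alpha>))) / p) * indicator {0<..} p \<partial>lborel)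
      = (\<integral>\<^sup>+p. \<integral>\<^sup>+y. ?g p y \<partial>lborel \<partial>lborel)"
    by (simp add: inner)
  also have "\<dots> = (\<integral>\<^sup>+y. \<integral>\<^sup>+p. ?g p y \<partial>lborel \<partial>lborel)"
    by (rule lborel_pair.Fubini'[symmetric]) measurable
  also have "\<dots> = (\<integral>\<^sup>+y. ennreal (1 / (\<alpha> * y)) * indicator {A..B} y \<partial>lborel)"
  proof (rule nn_integral_cong)
    fix y :: real
    show "(\<integral>\<^sup>+p. ?g p y \<partial>lborel) = ennreal (1 / (\<alpha> * y)) * indicator {A..B} y"
      using assms nn_integral_stretched_exponential[of y \<alpha>]
      by (cases "y \<in> {A..B}") auto
  qed
  also have "\<dots> = ennreal (ln B / \<alpha> - ln A / \<alpha>)"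
    by (rule nn_integral_Icc_FTC)
      (use assms in \<open>auto intro!: derivative_eq_intros simp: field_simps\<close>)
  also have "ln B / \<alpha> - ln A / \<alpha> = ln (B / A) / \<alpha>"
    using assms by (simp add: ln_div diff_divide_distrib)
  finally show ?thesis .
qed

section \<open>Integrals over (0, 1) against the weight 1 / (1 - m^2)\<close>

lemma nn_integral_unit_interval_powr:
  fixes c :: real
  assumes "0 < c"
  shows "(\<integral>\<^sup>+m. ennreal (m powr (c - 1)) * indicator {0<..<1} m \<partial>lborel) = ennreal (1 / c)"
proof -
  have "(\<integral>\<^sup>+m. ennreal (m powr (c - 1)) * indicator {0<..<1} m \<partial>lborel) = ennreal (1 / c - 0)"
  proof (rule nn_integral_unit_interval_FTC[where F = "\<lambda>m. m powr c / c"])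
    show "((\<lambda>m. m powr c / c) \<longlongrightarrow> 0) (at_right 0)" using assms by real_asymp
    show "((\<lambda>m. m powr c / c) \<longlongrightarrow> 1 / c) (at_left 1)" using assms by (real_asymp simp: field_simps)
  qed (use assms in \<open>auto intro!: derivative_eq_intros continuous_intros\<close>)
  then show ?thesis by simp
qed

lemma nn_integral_unit_interval_ln_power:
  "(\<integral>\<^sup>+m. ennreal (- ln m * m ^ (2 * k)) * indicator {0<..<1::real} m \<partial>lborel) = ennreal (1 / (2 * real k + 1)\<^sup>2)"
proof -
  define c where "c = 2 * real k + 1"
  have c: "0 < c" by (simp add: c_def)
  let ?F = "\<lambda>m. m powr c / c\<^sup>2 - ln m * m powr c / c"
  have "(\<integral>\<^sup>+m. ennreal (- ln m * m ^ (2 * k)) * indicator {0<..<1} m \<partial>lborel)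
      = (\<integral>\<^sup>+m. ennreal (- ln m * m powr (c - 1)) * indicator {0<..<1} m \<partial>lborel)"
    by (intro nn_integral_cong)
      (auto simp: c_def powr_realpow[symmetric] split: split_indicator)
  also have "\<dots> = ennreal (1 / c\<^sup>2 - 0)"
  proof (rule nn_integral_unit_interval_FTC[where F = ?F])
    fix m :: real assume m: "0 < m" "m < 1"
    show "DERIV ?F m :> - ln m * m powr (c - 1)"
      using m c by (auto intro!: derivative_eq_intros simp: field_simps power2_eq_square powr_diff)
    show "isCont (\<lambda>m. - ln m * m powr (c - 1)) m"
      using m by (auto intro!: continuous_intros)
  next
    show "(?F \<longlongrightarrow> 0) (at_right 0)" using c by real_asymp
    show "(?F \<longlongrightarrow> 1 / c\<^sup>2) (at_left 1)" using c by (real_asymp simp: field_simps)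
  qed (auto simp: mult_nonpos_nonneg)
  finally show ?thesis by (simp add: c_def)
qed

text \<open>Group the series for pi^2 / 6 into consecutive pairs, one odd and one even denominator
  each, and subtract the even part, which is a quarter of the whole series: pi^2 / 6 - pi^2 / 24 =
  pi^2 / 8.\<close>

lemma odd_inverse_squares_sums: "(\<lambda>k. 1 / (2 * real k + 1)\<^sup>2) sums (pi\<^sup>2 / 8)"
proof -
  let ?f = "\<lambda>n. 1 / (real n + 1)\<^sup>2"
  have f: "?f sums (pi\<^sup>2 / 6)"
    using inverse_squares_sums by (simp add: add.commute)
  have g: "(\<lambda>n. \<Sum>i = n * 2..<n * 2 + 2. ?f i) sums (pi\<^sup>2 / 6)"
    by (rule sums_group[OF f]) simp
  have "(\<lambda>n. 1 / 4 * ?f n) sums (1 / 4 * (pi\<^sup>2 / 6))"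
    by (rule sums_mult[OF f])
  from sums_diff[OF g this]
  have "(\<lambda>n. (\<Sum>i = n * 2..<n * 2 + 2. ?f i) - 1 / 4 * ?f n) sums (pi\<^sup>2 / 8)"
    by (simp add: field_simps)
  also have "(\<lambda>n. (\<Sum>i = n * 2..<n * 2 + 2. ?f i) - 1 / 4 * ?f n) = (\<lambda>k. 1 / (2 * real k + 1)\<^sup>2)"
  proof
    fix n :: nat
    have "1 / 4 * ?f n = 1 / (2 * real n + 2)\<^sup>2"
      by (simp add: power2_eq_square field_simps)
    then show "(\<Sum>i = n * 2..<n * 2 + 2. ?f i) - 1 / 4 * ?f n = 1 / (2 * real n + 1)\<^sup>2"
      by (simp add: numeral_2_eq_2 add.commute mult.commute)
  qed
  finally show ?thesis .
qed

text \<open>The weight expands as the geometric series in m^2, and for nonnegative \<open>g\<close>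
  sum and integral may be exchanged. This reduces integrals with the weight to moments of
  \<open>g\<close>.\<close>

lemma nn_integral_geometric_weight:
  fixes g :: "real \<Rightarrow> real"
  assumes [measurable]: "g \<in> borel_measurable borel" and g: "\<And>m. 0 < m \<Longrightarrow> m < 1 \<Longrightarrow> 0 \<le> g m"
  shows "(\<integral>\<^sup>+m. ennreal (g m / (1 - m\<^sup>2)) * indicator {0<..<1} m \<partial>lborel)
    = (\<Sum>k. \<integral>\<^sup>+m. ennreal (g m * m ^ (2 * k)) * indicator {0<..<1} m \<partial>lborel)"
proof -
  have "(\<integral>\<^sup>+m. ennreal (g m / (1 - m\<^sup>2)) * indicator {0<..<1} m \<partial>lborel)
      = (\<integral>\<^sup>+m. (\<Sum>k. ennreal (g m * m ^ (2 * k)) * indicator {0<..<1} m) \<partial>lborel)"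
  proof (rule nn_integral_cong)
    fix m :: real
    show "ennreal (g m / (1 - m\<^sup>2)) * indicator {0<..<1} m
        = (\<Sum>k. ennreal (g m * m ^ (2 * k)) * indicator {0<..<1} m)"
    proof (cases "m \<in> {0<..<1}")
      case True
      then have "m\<^sup>2 < 1" by (simp add: power_less_one_iff)
      then have "(\<lambda>k. (m\<^sup>2) ^ k) sums (1 / (1 - m\<^sup>2))"
        by (intro geometric_sums) simp
      from sums_mult[OF this, of "g m"]
      have "(\<lambda>k. g m * m ^ (2 * k)) sums (g m / (1 - m\<^sup>2))"
        by (simp add: power_mult)
      then show ?thesis
        using True g[of m] by (simp add: suminf_ennreal_eq[symmetric])
    qed simp
  qed
  also have "\<dots> = (\<Sum>k. \<integral>\<^sup>+m. ennreal (g m * m ^ (2 * k)) * indicator {0<..<1} m \<partial>lborel)"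
    by (rule nn_integral_suminf) measurable
  finally show ?thesis .
qed

lemma nn_integral_neg_ln_weight:
  "(\<integral>\<^sup>+m. ennreal (- ln m / (1 - m\<^sup>2)) * indicator {0<..<1::real} m \<partial>lborel) = ennreal (pi\<^sup>2 / 8)"
proof -
  have "(\<integral>\<^sup>+m. ennreal (- ln m / (1 - m\<^sup>2)) * indicator {0<..<1::real} m \<partial>lborel)
      = (\<Sum>k. \<integral>\<^sup>+m. ennreal (- ln m * m ^ (2 * k)) * indicator {0<..<1::real} m \<partial>lborel)"
    by (rule nn_integral_geometric_weight) auto
  also have "\<dots> = (\<Sum>k. ennreal (1 / (2 * real k + 1)\<^sup>2))"
    by (simp only: nn_integral_unit_interval_ln_power)
  also have "\<dots> = ennreal (pi\<^sup>2 / 8)"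
    by (intro suminf_ennreal_eq odd_inverse_squares_sums) auto
  finally show ?thesis .
qed

text \<open>With c = 2 k + 1, the k-th moment is 1 / (c - \<alpha>) - 1 / (c + \<alpha>) = 2
  \<alpha> / (c^2 - \<alpha>^2). Since c \<ge> 1, the denominator is at least (1 - \<alpha>^2) c^2,
  so the sum is dominated by that of the odd inverse squares.\<close>

lemma nn_integral_powr_diff_weight_le:
  fixes \<alpha> :: real
  assumes "0 < \<alpha>" "\<alpha> < 1"
  shows "(\<integral>\<^sup>+m. ennreal ((m powr (-\<alpha>) - m powr \<alpha>) / (1 - m\<^sup>2)) * indicator {0<..<1} m \<partial>lborel)
    \<le> ennreal (2 * \<alpha> / (1 - \<alpha>\<^sup>2) * (pi\<^sup>2 / 8))"
proof -
  have mono: "m powr \<alpha> \<le> m powr (-\<alpha>)" if "0 < m" "m < 1" for m :: real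
    using that assms by (intro powr_mono') auto
  have term_eq: "(\<integral>\<^sup>+m. ennreal ((m powr (-\<alpha>) - m powr \<alpha>) * m ^ (2 * k)) * indicator {0<..<1} m \<partial>lborel)
      = ennreal (1 / (2 * real k + 1 - \<alpha>) - 1 / (2 * real k + 1 + \<alpha>))" for k
  proof -
    define c where "c = 2 * real k + 1"
    let ?p = "\<lambda>e m. ennreal (m powr (c + e - 1)) * indicator {0<..<1} m :: ennreal"
    have "(\<integral>\<^sup>+m. ennreal ((m powr (-\<alpha>) - m powr \<alpha>) * m ^ (2 * k)) * indicator {0<..<1} m \<partial>lborel)
        = (\<integral>\<^sup>+m. ?p (-\<alpha>) m - ?p \<alpha> m \<partial>lborel)"
      by (intro nn_integral_cong)
        (auto simp: c_def powr_realpow[symmetric] powr_add[symmetric] left_diff_distrib algebra_simps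
          ennreal_minus split: split_indicator)
    also have "\<dots> = (\<integral>\<^sup>+m. ?p (-\<alpha>) m \<partial>lborel) - (\<integral>\<^sup>+m. ?p \<alpha> m \<partial>lborel)"
    proof (rule nn_integral_diff)
      show "(\<integral>\<^sup>+m. ?p \<alpha> m \<partial>lborel) \<noteq> \<infinity>"
        using nn_integral_unit_interval_powr[of "c + \<alpha>"] assms by (simp add: c_def)
      show "AE m in lborel. ?p \<alpha> m \<le> ?p (-\<alpha>) m"
        using assms by (intro AE_I2) (auto split: split_indicator intro!: ennreal_leI powr_mono')
    qed measurable
    also have "\<dots> = ennreal (1 / (c - \<alpha>)) - ennreal (1 / (c + \<alpha>))"
      using nn_integral_unit_interval_powr[of "c + \<alpha>"] nn_integral_unit_interval_powr[of "c - \<alpha>"] assms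
      by (simp add: c_def)
    also have "\<dots> = ennreal (1 / (c - \<alpha>) - 1 / (c + \<alpha>))"
      using assms by (intro ennreal_minus) (auto simp: c_def)
    finally show ?thesis by (simp add: c_def)
  qed
  have term_le: "1 / (2 * real k + 1 - \<alpha>) - 1 / (2 * real k + 1 + \<alpha>)
      \<le> 2 * \<alpha> / (1 - \<alpha>\<^sup>2) * (1 / (2 * real k + 1)\<^sup>2)" for k
  proof -
    define c where "c = 2 * real k + 1"
    have c: "1 \<le> c" by (simp add: c_def)
    have "(1 - \<alpha>\<^sup>2) * c\<^sup>2 \<le> c\<^sup>2 - \<alpha>\<^sup>2"
    proof -
      have "\<alpha>\<^sup>2 * 1 \<le> \<alpha>\<^sup>2 * c\<^sup>2"
        using c by (intro mult_left_mono) auto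
      then show ?thesis by (simp add: algebra_simps)
    qed
    moreover have "0 < (1 - \<alpha>\<^sup>2) * c\<^sup>2"
      using assms c by (auto simp: power_less_one_iff)
    ultimately have "2 * \<alpha> / (c\<^sup>2 - \<alpha>\<^sup>2) \<le> 2 * \<alpha> / ((1 - \<alpha>\<^sup>2) * c\<^sup>2)"
      using assms by (intro divide_left_mono mult_pos_pos) (auto simp: power_less_one_iff)
    moreover have "1 / (c - \<alpha>) - 1 / (c + \<alpha>) = 2 * \<alpha> / (c\<^sup>2 - \<alpha>\<^sup>2)"
      using assms c by (simp add: field_simps power2_eq_square)
    ultimately show ?thesis by (simp add: c_def)
  qed
  have "(\<integral>\<^sup>+m. ennreal ((m powr (-\<alpha>) - m powr \<alpha>) / (1 - m\<^sup>2)) * indicator {0<..<1} m \<partial>lborel)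
      = (\<Sum>k. ennreal (1 / (2 * real k + 1 - \<alpha>) - 1 / (2 * real k + 1 + \<alpha>)))"
    by (subst nn_integral_geometric_weight) (auto simp: term_eq mono)
  also have "\<dots> \<le> (\<Sum>k. ennreal (2 * \<alpha> / (1 - \<alpha>\<^sup>2) * (1 / (2 * real k + 1)\<^sup>2)))"
    by (intro suminf_le ennreal_leI term_le) auto
  also have "\<dots> = ennreal (2 * \<alpha> / (1 - \<alpha>\<^sup>2) * (pi\<^sup>2 / 8))"
    using assms by (intro suminf_ennreal_eq sums_mult odd_inverse_squares_sums)
      (auto simp: power_le_one_iff)
  finally show ?thesis .
qed


section \<open>Change of variables in the quadrant and the double sine integral\<close>

text \<open>The new coordinates are p = u + v and m = (u - v) / (u + v), with Jacobian p / 2; the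
  open quadrant becomes p > 0, -1 < m < 1. Two affine substitutions in one variable, v = p - u and
  then u = p (1 + m) / 2, with Tonelli around them, replace a planar change of variables.\<close>

lemma nn_integral_quadrant_rotation:
  fixes f :: "real \<Rightarrow> real \<Rightarrow> ennreal"
  assumes [measurable]: "case_prod f \<in> borel_measurable (borel \<Otimes>\<^sub>M borel)"
  shows "(\<integral>\<^sup>+u. \<integral>\<^sup>+v. f u v * indicator {0<..} u * indicator {0<..} v \<partial>lborel \<partial>lborel)
    = (\<integral>\<^sup>+m. \<integral>\<^sup>+p. f (p * (1 + m) / 2) (p * (1 - m) / 2) * ennreal (p / 2) * indicator {0<..} p
        * indicator {-1<..<1} m \<partial>lborel \<partial>lborel)"
proof -
  define g where "g u v = f u v * indicator {0<..} u * indicator {0<..} v" for u v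
  have [measurable]: "case_prod g \<in> borel_measurable (borel \<Otimes>\<^sub>M borel)"
    unfolding g_def by measurable
  have "(\<integral>\<^sup>+u. \<integral>\<^sup>+v. g u v \<partial>lborel \<partial>lborel) = (\<integral>\<^sup>+u. \<integral>\<^sup>+p. g u (p - u) \<partial>lborel \<partial>lborel)"
  proof (rule nn_integral_cong)
    fix u :: real
    show "(\<integral>\<^sup>+v. g u v \<partial>lborel) = (\<integral>\<^sup>+p. g u (p - u) \<partial>lborel)"
      using nn_integral_real_affine[of "g u" 1 "- u"] by simp
  qed
  also have "\<dots> = (\<integral>\<^sup>+p. \<integral>\<^sup>+u. g u (p - u) \<partial>lborel \<partial>lborel)"
    by (rule lborel_pair.Fubini'[symmetric]) measurable
  also have "\<dots> = (\<integral>\<^sup>+p. \<integral>\<^sup>+m. f (p * (1 + m) / 2) (p * (1 - m) / 2) * ennreal (p / 2) * indicator {0<..} p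
        * indicator {-1<..<1} m \<partial>lborel \<partial>lborel)"
  proof (rule nn_integral_cong)
    fix p :: real
    show "(\<integral>\<^sup>+u. g u (p - u) \<partial>lborel) = (\<integral>\<^sup>+m. f (p * (1 + m) / 2) (p * (1 - m) / 2) * ennreal (p / 2)
        * indicator {0<..} p * indicator {-1<..<1} m \<partial>lborel)"
    proof (cases "0 < p")
      case True
      have "(\<integral>\<^sup>+u. g u (p - u) \<partial>lborel)
          = ennreal (p / 2) * (\<integral>\<^sup>+m. g (p / 2 + p / 2 * m) (p - (p / 2 + p / 2 * m)) \<partial>lborel)"
        using True by (subst nn_integral_real_affine[where c = "p / 2" and t = "p / 2"]) auto
      also have "\<dots> = (\<integral>\<^sup>+m. ennreal (p / 2) * g (p / 2 + p / 2 * m) (p - (p / 2 + p / 2 * m)) \<partial>lborel)"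
        by (rule nn_integral_cmult[symmetric]) measurable
      also have "\<dots> = (\<integral>\<^sup>+m. f (p * (1 + m) / 2) (p * (1 - m) / 2) * ennreal (p / 2)
          * indicator {0<..} p * indicator {-1<..<1} m \<partial>lborel)"
      proof (rule nn_integral_cong)
        fix m :: real
        have e: "p / 2 + p / 2 * m = p * (1 + m) / 2" "p - p * (1 + m) / 2 = p * (1 - m) / 2"
          by (simp_all add: field_simps)
        have "0 < p * (1 + m) / 2 \<longleftrightarrow> -1 < m" "0 < p * (1 - m) / 2 \<longleftrightarrow> m < 1"
          using True by (auto simp: zero_less_mult_iff)
        then show "ennreal (p / 2) * g (p / 2 + p / 2 * m) (p - (p / 2 + p / 2 * m))
          = f (p * (1 + m) / 2) (p * (1 - m) / 2) * ennreal (p / 2)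
          * indicator {0<..} p * indicator {-1<..<1} m"
          using True unfolding e g_def by (auto simp: indicator_def mult_ac)
      qed
      finally show ?thesis .
    next
      case False
      then have "g u (p - u) = 0" for u
        by (auto simp: g_def indicator_def)
      then show ?thesis using False by simp
    qed
  qed
  also have "\<dots> = (\<integral>\<^sup>+m. \<integral>\<^sup>+p. f (p * (1 + m) / 2) (p * (1 - m) / 2) * ennreal (p / 2) * indicator {0<..} p
        * indicator {-1<..<1} m \<partial>lborel \<partial>lborel)"
    by (rule lborel_pair.Fubini'[symmetric]) measurable
  finally show ?thesis by (simp add: g_def)
qed

lemma nn_integral_even:
  fixes f :: "real \<Rightarrow> ennreal"
  assumes [measurable]: "f \<in> borel_measurable borel" and even: "\<And>x. f (- x) = f x"
  shows "(\<integral>\<^sup>+x. f x \<partial>lborel) = 2 * (\<integral>\<^sup>+x. f x * indicator {0<..} x \<partial>lborel)"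
proof -
  have "(\<integral>\<^sup>+x. f x \<partial>lborel) = (\<integral>\<^sup>+x. f x * indicator {0<..} x + f x * indicator {..<0} x \<partial>lborel)"
    using AE_lborel_singleton[of 0]
    by (intro nn_integral_cong_AE) (auto simp: indicator_def elim!: eventually_mono)
  also have "\<dots> = (\<integral>\<^sup>+x. f x * indicator {0<..} x \<partial>lborel) + (\<integral>\<^sup>+x. f x * indicator {..<0} x \<partial>lborel)"
    by (rule nn_integral_add) measurable
  also have "(\<integral>\<^sup>+x. f x * indicator {..<0} x \<partial>lborel) = (\<integral>\<^sup>+x. f x * indicator {0<..} x \<partial>lborel)"
    by (subst nn_integral_real_affine[where c = "-1" and t = 0])
      (auto simp: even indicator_def)
  finally show ?thesis by (simp add: mult_2)
qed

text \<open>With \<open>U = Z - b S\<close>, \<open>V = Z + b S\<close> and \<open>T = b\<^sup>\<alpha>\<close>, the integrand is \<open>E [sin (u U) sin (v V)] / (u v)\<close>.\<close>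

lemma nn_integral_sine_kernel:
  fixes \<alpha> T :: real
  assumes "0 < \<alpha>" "0 < T" "T < 1"
  shows "(\<integral>\<^sup>+u. \<integral>\<^sup>+v. ennreal ((exp (- (\<bar>u - v\<bar> powr \<alpha> + T * (u + v) powr \<alpha>))
        - exp (- ((u + v) powr \<alpha> + T * \<bar>u - v\<bar> powr \<alpha>))) / (2 * u * v))
        * indicator {0<..} u * indicator {0<..} v \<partial>lborel \<partial>lborel)
    = ennreal (2 / \<alpha>) * (\<integral>\<^sup>+m. ennreal (ln ((1 + T * m powr \<alpha>) / (m powr \<alpha> + T)) / (1 - m\<^sup>2))
        * indicator {0<..<1} m \<partial>lborel)" (is "?lhs = _ * ?R")
proof -
  let ?f = "\<lambda>u v. ennreal ((exp (- (\<bar>u - v\<bar> powr \<alpha> + T * (u + v) powr \<alpha>))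
        - exp (- ((u + v) powr \<alpha> + T * \<bar>u - v\<bar> powr \<alpha>))) / (2 * u * v))"
  let ?L = "\<lambda>m. ln ((1 + T * \<bar>m\<bar> powr \<alpha>) / (\<bar>m\<bar> powr \<alpha> + T)) / (1 - m\<^sup>2)"
  have meas: "case_prod ?f \<in> borel_measurable (borel \<Otimes>\<^sub>M borel)"
    by measurable
  have "?lhs = (\<integral>\<^sup>+m. \<integral>\<^sup>+p. ?f (p * (1 + m) / 2) (p * (1 - m) / 2) * ennreal (p / 2) * indicator {0<..} p
        * indicator {-1<..<1} m \<partial>lborel \<partial>lborel)"
    by (rule nn_integral_quadrant_rotation[OF meas])
  also have "\<dots> = (\<integral>\<^sup>+m. ennreal (1 / \<alpha>) * (ennreal (?L m) * indicator {-1<..<1} m) \<partial>lborel)"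
  proof (rule nn_integral_cong)
    fix m :: real
    show "(\<integral>\<^sup>+p. ?f (p * (1 + m) / 2) (p * (1 - m) / 2) * ennreal (p / 2) * indicator {0<..} p
        * indicator {-1<..<1} m \<partial>lborel) = ennreal (1 / \<alpha>) * (ennreal (?L m) * indicator {-1<..<1} m)"
    proof (cases "m \<in> {-1<..<1}")
      case True
      \<comment> \<open>After the rotation u + v = p and |u - v| = p |m|, so the two exponents are
        \<open>A * p powr \<alpha>\<close> and \<open>B * p powr \<alpha>\<close>, and the integral
        over p is of Frullani type. The order A \<le> B comes from B - A = (1 - T) (1 -
        |m|^\<alpha>).\<close>
      define A where "A = \<bar>m\<bar> powr \<alpha> + T"
      define B where "B = 1 + T * \<bar>m\<bar> powr \<alpha>"
      have q: "0 \<le> \<bar>m\<bar> powr \<alpha>" "\<bar>m\<bar> powr \<alpha> \<le> 1"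
        using True assms by (auto intro!: powr_le1)
      have A: "0 < A" using q assms by (simp add: A_def add_nonneg_pos)
      have AB: "A \<le> B"
      proof -
        have "0 \<le> (1 - T) * (1 - \<bar>m\<bar> powr \<alpha>)" using q assms by simp
        then show ?thesis by (simp add: A_def B_def algebra_simps)
      qed
      have m2: "0 < 1 - m\<^sup>2"
        using True by (auto simp: abs_square_less_1)
      have "(\<integral>\<^sup>+p. ?f (p * (1 + m) / 2) (p * (1 - m) / 2) * ennreal (p / 2) * indicator {0<..} p
          * indicator {-1<..<1} m \<partial>lborel)
        = (\<integral>\<^sup>+p. ennreal (1 / (1 - m\<^sup>2)) * (ennreal ((exp (- (A * p powr \<alpha>)) - exp (- (B * p powr \<alpha>))) / p)
            * indicator {0<..} p) \<partial>lborel)"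
      proof (rule nn_integral_cong)
        fix p :: real
        show "?f (p * (1 + m) / 2) (p * (1 - m) / 2) * ennreal (p / 2) * indicator {0<..} p
          * indicator {-1<..<1} m
          = ennreal (1 / (1 - m\<^sup>2)) * (ennreal ((exp (- (A * p powr \<alpha>)) - exp (- (B * p powr \<alpha>))) / p)
            * indicator {0<..} p)"
        proof (cases "0 < p")
          case p: True
          have e1: "p * (1 + m) / 2 - p * (1 - m) / 2 = p * m" "p * (1 + m) / 2 + p * (1 - m) / 2 = p"
            by (simp_all add: field_simps)
          have e2: "\<bar>p * m\<bar> powr \<alpha> = p powr \<alpha> * \<bar>m\<bar> powr \<alpha>"
            using p by (simp add: abs_mult powr_mult)
          have e4: "p powr \<alpha> * \<bar>m\<bar> powr \<alpha> + T * p powr \<alpha> = A * p powr \<alpha>"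
              "p powr \<alpha> + T * (p powr \<alpha> * \<bar>m\<bar> powr \<alpha>) = B * p powr \<alpha>"
            by (simp_all add: A_def B_def algebra_simps)
          \<comment> \<open>The factor p / 2 cancels against the Jacobian; what remains is the 1 / p
            of the Frullani integrand and the weight 1 / (1 - m^2).\<close>
          have e3: "2 * (p * (1 + m) / 2) * (p * (1 - m) / 2) = p / 2 * (p * (1 - m\<^sup>2))"
            by (simp add: field_simps power2_eq_square)
          have "?f (p * (1 + m) / 2) (p * (1 - m) / 2) * ennreal (p / 2)
             = ennreal ((exp (- (A * p powr \<alpha>)) - exp (- (B * p powr \<alpha>))) / (p / 2 * (p * (1 - m\<^sup>2))) * (p / 2))"
            unfolding e1 e2 e3 e4 using p by (intro ennreal_mult''[symmetric]) simp
          also have "\<dots> = ennreal (1 / (1 - m\<^sup>2) * ((exp (- (A * p powr \<alpha>)) - exp (- (B * p powr \<alpha>))) / p))"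
            using p m2 by (intro arg_cong[where f = ennreal]) (simp add: field_simps)
          also have "\<dots> = ennreal (1 / (1 - m\<^sup>2)) * ennreal ((exp (- (A * p powr \<alpha>)) - exp (- (B * p powr \<alpha>))) / p)"
            using p m2 AB by (intro ennreal_mult) (auto intro!: divide_nonneg_pos mult_right_mono)
          finally show ?thesis using p True by simp
        qed simp
      qed
      also have "\<dots> = ennreal (1 / (1 - m\<^sup>2)) * ennreal (ln (B / A) / \<alpha>)"
        using A AB assms
        by (subst nn_integral_cmult) (auto simp: frullani_stretched_exponential)
      also have "\<dots> = ennreal (1 / \<alpha>) * ennreal (ln (B / A) / (1 - m\<^sup>2))"
        using A AB assms m2 by (simp add: ennreal_mult'[symmetric] mult.commute)
      finally show ?thesis using True by (simp add: A_def B_def)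
    qed simp
  qed
  also have "\<dots> = ennreal (1 / \<alpha>) * (\<integral>\<^sup>+m. ennreal (?L m) * indicator {-1<..<1} m \<partial>lborel)"
    by (rule nn_integral_cmult) measurable
  \<comment> \<open>The integrand is even in m, so folding onto (0, 1) turns the constant 1 /
    \<alpha> into 2 / \<alpha>.\<close>
  also have "(\<integral>\<^sup>+m. ennreal (?L m) * indicator {-1<..<1} m \<partial>lborel)
      = 2 * (\<integral>\<^sup>+m. ennreal (?L m) * indicator {-1<..<1} m * indicator {0<..} m \<partial>lborel)"
    by (rule nn_integral_even) (auto simp: indicator_def)
  also have "(\<integral>\<^sup>+m. ennreal (?L m) * indicator {-1<..<1} m * indicator {0<..} m \<partial>lborel) = ?R"
    by (intro nn_integral_cong) (auto simp: indicator_def)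
  also have "ennreal (1 / \<alpha>) * (2 * ?R) = ennreal (2 / \<alpha>) * ?R"
    using assms by (simp add: mult.assoc[symmetric] ennreal_mult'[symmetric] flip: ennreal_numeral)
  finally show ?thesis .
qed

section \<open>Two inequalities for the logarithmic integrand\<close>

text \<open>Put r = (1 + P) / (1 + Q). Concavity of \<open>ln\<close> between 1 and r gives t ln r
  \<le> ln (1 + t (r - 1)), and t (r - 1) = t (P - Q) / (1 + Q) only grows when Q in the denominator
  is replaced by the smaller t Q. Later P and Q are the multiples of m^(-\<alpha>) and m^\<alpha> by
  b^\<alpha>.\<close>

lemma ln_ratio_concave:
  fixes P Q t :: real
  assumes "0 \<le> Q" "Q \<le> P" "0 \<le> t" "t \<le> 1"
  shows "t * ln ((1 + P) / (1 + Q)) \<le> ln ((1 + t * P) / (1 + t * Q))"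
proof -
  define r where "r = (1 + P) / (1 + Q)"
  have r: "1 \<le> r" using assms by (simp add: r_def)
  have "t * ln r = (1 - t) * ln 1 + t * ln r" by simp
  also have "\<dots> \<le> ln ((1 - t) * 1 + t * r)"
    using concave_onD[OF ln_concave, of t 1 r] assms r by simp
  also have "\<dots> \<le> ln ((1 + t * P) / (1 + t * Q))"
  proof -
    have "(1 - t) * 1 + t * r = 1 + t * (P - Q) / (1 + Q)"
      using assms by (simp add: r_def field_simps)
    also have "\<dots> \<le> 1 + t * (P - Q) / (1 + t * Q)"
      using assms mult_left_le_one_le[of Q t]
      by (intro add_left_mono divide_left_mono) (auto intro!: mult_pos_pos add_pos_nonneg)
    also have "\<dots> = (1 + t * P) / (1 + t * Q)"
    proof -
      have "0 < 1 + t * Q" using assms by (intro add_pos_nonneg) auto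
      then have "1 + t * (P - Q) / (1 + t * Q) = ((1 + t * Q) + t * (P - Q)) / (1 + t * Q)"
        by (simp add: add_divide_distrib)
      then show ?thesis by (simp add: algebra_simps)
    qed
    finally have "(1 - t) * 1 + t * r \<le> (1 + t * P) / (1 + t * Q)" .
    moreover have "0 < (1 - t) * 1 + t * r"
    proof -
      have "(1 - t) * 1 + t * r = 1 + t * (r - 1)" by (simp add: algebra_simps)
      moreover have "0 \<le> t * (r - 1)" using r assms by simp
      ultimately show ?thesis by linarith
    qed
    ultimately show ?thesis by (subst ln_le_cancel_iff) auto
  qed
  finally show ?thesis by (simp add: r_def)
qed

text \<open>Apply ln y \<le> y - 1 and drop the denominator 1 + Q \<ge> 1. This makes the integrand
  linear in b^\<alpha>.\<close>

lemma ln_ratio_le_diff: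
  fixes P Q :: real
  assumes "0 \<le> Q" "Q \<le> P"
  shows "ln ((1 + P) / (1 + Q)) \<le> P - Q"
proof -
  have "ln ((1 + P) / (1 + Q)) \<le> (1 + P) / (1 + Q) - 1"
    using assms by (intro ln_le_minus_one) auto
  also have "\<dots> = (P - Q) / (1 + Q)" using assms by (simp add: field_simps)
  also have "\<dots> \<le> (P - Q) / 1" using assms by (intro divide_left_mono) auto
  finally show ?thesis by simp
qed

section \<open>The ratio of two independent stable variables\<close>

text \<open>This is a truncation of the Dirichlet integral for (pi / 2) sgn y. Away from 0 and
  infinity the kernel is bounded on a set of finite measure, as Fubini will require, and the form in
  terms of \<open>Si\<close> gives a bound uniform in the truncation.\<close>

lemma integral_sin_divide_Icc:
  fixes a b y :: real
  assumes "0 < a" "a \<le> b"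
  shows "(\<integral>u. sin (u * y) / u \<partial>restrict_space lborel {a..b}) = sgn y * (Si (b * \<bar>y\<bar>) - Si (a * \<bar>y\<bar>))"
proof -
  let ?f = "\<lambda>u. sin (u * y) / u"
  \<comment> \<open>The integral from \<open>a\<close> to \<open>b\<close> is split as a difference
    of two integrals from 0, which needs integrability on the hull of 0, \<open>a\<close> and
    \<open>b\<close>.\<close>
  have int: "interval_lebesgue_integrable lborel (min (ereal 0) (min (ereal a) (ereal b)))
      (max (ereal 0) (max (ereal a) (ereal b))) ?f"
    using assms integrable_sinc'[of b y] by (simp add: min_def max_def)
  have "(\<integral>u. ?f u \<partial>restrict_space lborel {a..b}) = (LBINT u:{a..b}. ?f u)"
    by (subst integral_restrict_space) (auto simp: set_lebesgue_integral_def)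
  also have "\<dots> = (LBINT u=ereal a..ereal b. ?f u)"
    using assms by (simp add: interval_integral_Icc)
  also have "\<dots> = (LBINT u=ereal 0..ereal b. ?f u) - (LBINT u=ereal 0..ereal a. ?f u)"
    using interval_integral_sum[OF int] by simp
  also have "\<dots> = sgn y * Si (b * \<bar>y\<bar>) - sgn y * Si (a * \<bar>y\<bar>)"
    using assms LBINT_I0c_sin_scale_divide[of b y] LBINT_I0c_sin_scale_divide[of a y]
    by (simp add: zero_ereal_def)
  finally show ?thesis by (simp add: right_diff_distrib)
qed

section \<open>The sign correlation of an independent stable pair\<close>

text \<open>In the application \<open>S\<close> is the entry that multiplies the fixed coordinate,
  and \<open>Z\<close> is the rest of the measurement divided by \<theta>.\<close>

locale iid_stable_pair = prob_space M for M :: "'a measure" +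
  fixes S Z :: "'a \<Rightarrow> real" and \<alpha> :: real
  assumes indep: "indep_var borel S borel Z"
    and char_S: "\<And>t. char (distr M borel S) t = complex_of_real (exp (- (\<bar>t\<bar> powr \<alpha>)))"
    and char_Z: "\<And>t. char (distr M borel Z) t = complex_of_real (exp (- (\<bar>t\<bar> powr \<alpha>)))"
    and \<alpha>: "0 < \<alpha>" "\<alpha> < 1"
begin

lemma measurable_S[measurable]: "S \<in> borel_measurable M"
  and measurable_Z[measurable]: "Z \<in> borel_measurable M"
  using indep_var_rv1[OF indep] indep_var_rv2[OF indep] by auto

text \<open>The cosine is the real part of the complex exponential, whose expectation is the
  characteristic function of \<open>q * S + p * Z\<close> at 1; by independence it factors.\<close>

lemma expectation_cos:
  "expectation (\<lambda>\<omega>. cos (p * Z \<omega> + q * S \<omega>)) = exp (- (\<bar>p\<bar> powr \<alpha> + \<bar>q\<bar> powr \<alpha>))"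
proof -
  have ind: "indep_var borel (\<lambda>\<omega>. q * S \<omega>) borel (\<lambda>\<omega>. p * Z \<omega>)"
    using indep_var_compose[OF indep, of "\<lambda>x. q * x" borel "\<lambda>x. p * x" borel] by (simp add: comp_def)
  have "expectation (\<lambda>\<omega>. cos (p * Z \<omega> + q * S \<omega>)) = (\<integral>\<omega>. Re (iexp (q * S \<omega> + p * Z \<omega>)) \<partial>M)"
    by (intro Bochner_Integration.integral_cong) (simp_all only: cis_conv_exp[symmetric] cis.simps add.commute)
  also have "\<dots> = Re (\<integral>\<omega>. iexp (q * S \<omega> + p * Z \<omega>) \<partial>M)"
    by (intro integral_Re integrable_const_bound[where B = 1]) auto
  also have "(\<integral>\<omega>. iexp (q * S \<omega> + p * Z \<omega>) \<partial>M) = char (distr M borel (\<lambda>\<omega>. q * S \<omega> + p * Z \<omega>)) 1"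
    by (simp add: char_def integral_distr)
  also have "\<dots> = char (distr M borel (\<lambda>\<omega>. q * S \<omega>)) 1 * char (distr M borel (\<lambda>\<omega>. p * Z \<omega>)) 1"
    by (rule char_distr_add[OF ind])
  also have "char (distr M borel (\<lambda>\<omega>. q * S \<omega>)) 1 = char (distr M borel S) q"
    by (simp add: char_def integral_distr)
  also have "char (distr M borel (\<lambda>\<omega>. p * Z \<omega>)) 1 = char (distr M borel Z) p"
    by (simp add: char_def integral_distr)
  finally show ?thesis
    by (simp add: char_S char_Z exp_add[symmetric] of_real_mult[symmetric] del: of_real_mult of_real_exp)
qed

text \<open>The product formula for sines leaves the cosines of (u - v) Z - b (u + v) S and of (u +
  v) Z + b (v - u) S, whose expectations are known.\<close>

lemma expectation_sin_sin:
  assumes "0 < u" "0 < v" "0 < b"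
  shows "expectation (\<lambda>\<omega>. sin (u * (Z \<omega> - b * S \<omega>)) / u * (sin (v * (Z \<omega> + b * S \<omega>)) / v))
    = (exp (- (\<bar>u - v\<bar> powr \<alpha> + b powr \<alpha> * (u + v) powr \<alpha>))
        - exp (- ((u + v) powr \<alpha> + b powr \<alpha> * \<bar>u - v\<bar> powr \<alpha>))) / (2 * u * v)"
proof -
  have "expectation (\<lambda>\<omega>. sin (u * (Z \<omega> - b * S \<omega>)) / u * (sin (v * (Z \<omega> + b * S \<omega>)) / v))
    = expectation (\<lambda>\<omega>. (cos ((u - v) * Z \<omega> + (- (b * (u + v))) * S \<omega>)
        - cos ((u + v) * Z \<omega> + (b * (v - u)) * S \<omega>)) / (2 * u * v))"
    by (intro Bochner_Integration.integral_cong)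
      (auto simp: sin_times_sin algebra_simps)
  also have "\<dots> = (expectation (\<lambda>\<omega>. cos ((u - v) * Z \<omega> + (- (b * (u + v))) * S \<omega>))
        - expectation (\<lambda>\<omega>. cos ((u + v) * Z \<omega> + (b * (v - u)) * S \<omega>))) / (2 * u * v)"
  proof -
    have "integrable M (\<lambda>\<omega>. cos (p * Z \<omega> + q * S \<omega>))" for p q
      by (intro integrable_const_bound[where B = 1]) auto
    then show ?thesis
      by (simp only: integral_divide_zero Bochner_Integration.integral_diff)
  qed
  finally show ?thesis
    using assms unfolding expectation_cos
    by (simp add: abs_mult powr_mult abs_minus_commute)
qed

text \<open>On \<open>{a..c}\<close> the kernels are bounded by 1 / a, so Fubini on a finite product
  measure moves the expectation inside. Since the resulting \<open>H\<close> is nonnegative, the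
  outcome can be stated with nonnegative integrals, ready for monotone convergence in the
  truncation.\<close>

lemma expectation_truncated_kernels:
  assumes "0 < a" "a \<le> c" "0 < b" "b < 1"
  defines "H \<equiv> \<lambda>u v. (exp (- (\<bar>u - v\<bar> powr \<alpha> + b powr \<alpha> * (u + v) powr \<alpha>))
        - exp (- ((u + v) powr \<alpha> + b powr \<alpha> * \<bar>u - v\<bar> powr \<alpha>))) / (2 * u * v)"
  defines "K \<equiv> \<lambda>y. sgn y * (Si (c * \<bar>y\<bar>) - Si (a * \<bar>y\<bar>))"
  shows "0 \<le> expectation (\<lambda>\<omega>. K (Z \<omega> - b * S \<omega>) * K (Z \<omega> + b * S \<omega>))"
    and "ennreal (expectation (\<lambda>\<omega>. K (Z \<omega> - b * S \<omega>) * K (Z \<omega> + b * S \<omega>)))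
      = (\<integral>\<^sup>+u. \<integral>\<^sup>+v. ennreal (H u v) * indicator {a..c} u * indicator {a..c} v \<partial>lborel \<partial>lborel)"
proof -
  define \<nu> where "\<nu> = restrict_space lborel {a..c}"
  have sp: "space \<nu> = {a..c}" by (simp add: \<nu>_def space_restrict_space)
  have [measurable]: "(\<lambda>x. x) \<in> borel_measurable \<nu>"
    unfolding \<nu>_def by (intro measurable_restrict_space1) simp
  interpret \<nu>: finite_measure \<nu>
    using assms by (intro finite_measureI) (simp add: \<nu>_def emeasure_restrict_space space_restrict_space)
  interpret \<nu>2: pair_sigma_finite \<nu> \<nu> ..
  interpret \<nu>\<nu>: finite_measure "\<nu> \<Otimes>\<^sub>M \<nu>"
    by (rule finite_measure_pair_measure) unfold_locales
  interpret P: pair_sigma_finite M "\<nu> \<Otimes>\<^sub>M \<nu>" ..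
  interpret PF: finite_measure "M \<Otimes>\<^sub>M (\<nu> \<Otimes>\<^sub>M \<nu>)"
    by (rule finite_measure_pair_measure) unfold_locales
  define k where "k u y = sin (u * y) / u" for u y :: real
  have [measurable]: "case_prod k \<in> borel_measurable (borel \<Otimes>\<^sub>M borel)"
    unfolding k_def by measurable
  have K: "K y = (\<integral>u. k u y \<partial>\<nu>)" for y
    unfolding K_def k_def \<nu>_def using assms by (simp add: integral_sin_divide_Icc)
  have kb: "\<bar>k u y\<bar> \<le> 1 / a" if "u \<in> {a..c}" for u y
  proof -
    have "\<bar>k u y\<bar> = \<bar>sin (u * y)\<bar> / u" using that assms by (simp add: k_def)
    also have "\<dots> \<le> 1 / a" using that assms by (intro frac_le) auto
    finally show ?thesis .
  qed
  define B where "B = 1 / a * (1 / a)"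
  have kkb: "\<bar>k u y * k v y'\<bar> \<le> B" if "u \<in> {a..c}" "v \<in> {a..c}" for u v y y'
    unfolding B_def abs_mult using kb[of u y] kb[of v y'] that assms by (intro mult_mono) auto
  define F where "F \<omega> z = k (fst z) (Z \<omega> - b * S \<omega>) * k (snd z) (Z \<omega> + b * S \<omega>)" for \<omega> z
  have [measurable]: "case_prod F \<in> borel_measurable (M \<Otimes>\<^sub>M (\<nu> \<Otimes>\<^sub>M \<nu>))"
    unfolding F_def by measurable
  have Fint: "integrable (M \<Otimes>\<^sub>M (\<nu> \<Otimes>\<^sub>M \<nu>)) (case_prod F)"
    by (rule PF.integrable_const_bound[where B = B])
      (auto simp: F_def space_pair_measure sp intro!: AE_I2 kkb)
  have EF: "expectation (\<lambda>\<omega>. F \<omega> (u, v)) = H u v" if "u \<in> {a..c}" "v \<in> {a..c}" for u v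
    unfolding F_def k_def H_def using that assms by (simp only: fst_conv snd_conv, subst expectation_sin_sin) auto
  have KK: "K (Z \<omega> - b * S \<omega>) * K (Z \<omega> + b * S \<omega>) = (\<integral>z. F \<omega> z \<partial>(\<nu> \<Otimes>\<^sub>M \<nu>))" if "\<omega> \<in> space M" for \<omega>
  proof -
    have "integrable (\<nu> \<Otimes>\<^sub>M \<nu>) (F \<omega>)"
      using that by (intro \<nu>\<nu>.integrable_const_bound[where B = B])
        (auto simp: F_def space_pair_measure sp intro!: AE_I2 kkb)
    then have "(\<integral>z. F \<omega> z \<partial>(\<nu> \<Otimes>\<^sub>M \<nu>)) = (\<integral>u. \<integral>v. F \<omega> (u, v) \<partial>\<nu> \<partial>\<nu>)"
      by (rule \<nu>2.integral_fst'[symmetric])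
    then show ?thesis by (simp add: F_def K)
  qed
  \<comment> \<open>The exponents differ by (1 - b^\<alpha>) ((u + v)^\<alpha> - |u - v|^\<alpha>),
    which is nonnegative because b < 1.\<close>
  have H0: "0 \<le> H u v" if "u \<in> {a..c}" "v \<in> {a..c}" for u v
  proof -
    have u: "0 < u" "0 < v" using that assms by auto
    have "\<bar>u - v\<bar> powr \<alpha> \<le> (u + v) powr \<alpha>"
      using u \<alpha> by (intro powr_mono2) auto
    moreover have "b powr \<alpha> \<le> 1" using assms \<alpha> by (intro powr_le1) auto
    ultimately have "0 \<le> (1 - b powr \<alpha>) * ((u + v) powr \<alpha> - \<bar>u - v\<bar> powr \<alpha>)" by simp
    then show ?thesis
      unfolding H_def using u by (intro divide_nonneg_pos) (auto simp: algebra_simps)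
  qed
  have "expectation (\<lambda>\<omega>. K (Z \<omega> - b * S \<omega>) * K (Z \<omega> + b * S \<omega>))
      = (\<integral>\<omega>. \<integral>z. F \<omega> z \<partial>(\<nu> \<Otimes>\<^sub>M \<nu>) \<partial>M)"
    by (intro Bochner_Integration.integral_cong) (auto simp: KK)
  also have "\<dots> = (\<integral>z. \<integral>\<omega>. F \<omega> z \<partial>M \<partial>(\<nu> \<Otimes>\<^sub>M \<nu>))"
    by (rule P.Fubini_integral[symmetric, OF Fint])
  also have "\<dots> = (\<integral>z. H (fst z) (snd z) \<partial>(\<nu> \<Otimes>\<^sub>M \<nu>))"
    by (intro Bochner_Integration.integral_cong) (auto simp: space_pair_measure sp EF)
  finally have E: "expectation (\<lambda>\<omega>. K (Z \<omega> - b * S \<omega>) * K (Z \<omega> + b * S \<omega>))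
      = (\<integral>z. H (fst z) (snd z) \<partial>(\<nu> \<Otimes>\<^sub>M \<nu>))" .
  have "integrable (\<nu> \<Otimes>\<^sub>M \<nu>) (\<lambda>z. \<integral>\<omega>. F \<omega> z \<partial>M)"
    by (rule P.integrable_snd[OF Fint])
  also have "?this \<longleftrightarrow> integrable (\<nu> \<Otimes>\<^sub>M \<nu>) (\<lambda>z. H (fst z) (snd z))"
    by (intro Bochner_Integration.integrable_cong) (auto simp: space_pair_measure sp EF)
  finally have Hint: "integrable (\<nu> \<Otimes>\<^sub>M \<nu>) (\<lambda>z. H (fst z) (snd z))" .
  show "0 \<le> expectation (\<lambda>\<omega>. K (Z \<omega> - b * S \<omega>) * K (Z \<omega> + b * S \<omega>))"
    unfolding E by (intro integral_nonneg_AE AE_I2) (auto simp: space_pair_measure sp H0)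
  have [measurable]: "case_prod H \<in> borel_measurable (borel \<Otimes>\<^sub>M borel)"
    unfolding H_def by measurable
  have "ennreal (expectation (\<lambda>\<omega>. K (Z \<omega> - b * S \<omega>) * K (Z \<omega> + b * S \<omega>)))
      = (\<integral>\<^sup>+z. ennreal (H (fst z) (snd z)) \<partial>(\<nu> \<Otimes>\<^sub>M \<nu>))"
    unfolding E by (intro nn_integral_eq_integral[symmetric] Hint AE_I2) (auto simp: space_pair_measure sp H0)
  also have "\<dots> = (\<integral>\<^sup>+u. \<integral>\<^sup>+v. ennreal (H u v) \<partial>\<nu> \<partial>\<nu>)"
    by (subst \<nu>.nn_integral_fst[symmetric]) auto
  also have "\<dots> = (\<integral>\<^sup>+u. \<integral>\<^sup>+v. ennreal (H u v) * indicator {a..c} u * indicator {a..c} v \<partial>lborel \<partial>lborel)"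
    unfolding \<nu>_def
    by (auto simp: nn_integral_restrict_space indicator_def intro!: nn_integral_cong)
  finally show "ennreal (expectation (\<lambda>\<omega>. K (Z \<omega> - b * S \<omega>) * K (Z \<omega> + b * S \<omega>)))
      = (\<integral>\<^sup>+u. \<integral>\<^sup>+v. ennreal (H u v) * indicator {a..c} u * indicator {a..c} v \<partial>lborel \<partial>lborel)" .
qed

text \<open>The intervals from 1 / (n + 1) to n + 1 exhaust the half-line. The expectation converges
  by dominated convergence, as \<open>Si\<close> is bounded, and the double integral by monotone
  convergence. The constant pi^2 / 4 is the product of two Dirichlet limits pi / 2.\<close>

lemma expectation_sgn_sgn:
  assumes b: "0 < b" "b < 1"
  defines "D \<equiv> expectation (\<lambda>\<omega>. sgn (Z \<omega> - b * S \<omega>) * sgn (Z \<omega> + b * S \<omega>))"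
  shows "0 \<le> D"
    and "ennreal (pi\<^sup>2 / 4 * D) = ennreal (2 / \<alpha>) *
      (\<integral>\<^sup>+m. ennreal (ln ((1 + b powr \<alpha> * m powr \<alpha>) / (m powr \<alpha> + b powr \<alpha>)) / (1 - m\<^sup>2))
        * indicator {0<..<1} m \<partial>lborel)"
proof -
  define H where "H u v = (exp (- (\<bar>u - v\<bar> powr \<alpha> + b powr \<alpha> * (u + v) powr \<alpha>))
        - exp (- ((u + v) powr \<alpha> + b powr \<alpha> * \<bar>u - v\<bar> powr \<alpha>))) / (2 * u * v)" for u v
  have [measurable]: "case_prod H \<in> borel_measurable (borel \<Otimes>\<^sub>M borel)"
    unfolding H_def by measurable
  define a c where "a n = 1 / (real n + 1)" and "c n = real n + 1" for n
  have ac: "0 < a n" "a n \<le> c n" for n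
  proof -
    have "a n \<le> 1" "1 \<le> c n" by (auto simp: a_def c_def)
    then show "a n \<le> c n" by linarith
  qed (simp add: a_def)
  define K where "K n y = sgn y * (Si (c n * \<bar>y\<bar>) - Si (a n * \<bar>y\<bar>))" for n y
  note trunc = expectation_truncated_kernels[OF ac b, folded H_def K_def]
  have [measurable]: "K n \<in> borel_measurable borel" for n
    unfolding K_def by measurable
  obtain C where C: "\<And>t. \<bar>Si t\<bar> \<le> C" using bounded_Si by blast
  have Kb: "\<bar>K n y\<bar> \<le> 2 * C" for n y
  proof -
    have "\<bar>K n y\<bar> \<le> \<bar>Si (c n * \<bar>y\<bar>) - Si (a n * \<bar>y\<bar>)\<bar>"
      by (auto simp: K_def abs_mult sgn_real_def)
    also have "\<dots> \<le> 2 * C" using C[of "c n * \<bar>y\<bar>"] C[of "a n * \<bar>y\<bar>"] by linarith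
    finally show ?thesis .
  qed
  have a0: "a \<longlonglongrightarrow> 0" unfolding a_def by real_asymp
  have cinf: "filterlim c at_top sequentially" unfolding c_def by real_asymp
  have Klim: "(\<lambda>n. K n y) \<longlonglongrightarrow> pi / 2 * sgn y" for y
  proof (cases "y = 0")
    case False
    have "(\<lambda>n. Si (c n * \<bar>y\<bar>)) \<longlonglongrightarrow> pi / 2"
      using False by (intro filterlim_compose[OF Si_at_top] filterlim_at_top_mult_tendsto_pos[OF tendsto_const _ cinf]) auto
    moreover have "(\<lambda>n. Si (a n * \<bar>y\<bar>)) \<longlonglongrightarrow> Si (0 * \<bar>y\<bar>)"
      by (intro isCont_tendsto_compose[OF isCont_Si] tendsto_intros a0)
    ultimately have "(\<lambda>n. K n y) \<longlonglongrightarrow> sgn y * (pi / 2 - Si (0 * \<bar>y\<bar>))"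
      unfolding K_def by (intro tendsto_intros)
    then show ?thesis by (simp add: Si_def zero_ereal_def mult.commute)
  qed (simp add: K_def)
  have "(\<lambda>n. expectation (\<lambda>\<omega>. K n (Z \<omega> - b * S \<omega>) * K n (Z \<omega> + b * S \<omega>)))
      \<longlonglongrightarrow> expectation (\<lambda>\<omega>. (pi / 2 * sgn (Z \<omega> - b * S \<omega>)) * (pi / 2 * sgn (Z \<omega> + b * S \<omega>)))"
  proof (rule integral_dominated_convergence[where w = "\<lambda>_. 2 * C * (2 * C)"])
    show "AE \<omega> in M. norm (K n (Z \<omega> - b * S \<omega>) * K n (Z \<omega> + b * S \<omega>)) \<le> 2 * C * (2 * C)" for n
      unfolding real_norm_def abs_mult using C[of 0] by (intro AE_I2 mult_mono Kb) auto
    show "AE \<omega> in M. (\<lambda>n. K n (Z \<omega> - b * S \<omega>) * K n (Z \<omega> + b * S \<omega>))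
      \<longlonglongrightarrow> (pi / 2 * sgn (Z \<omega> - b * S \<omega>)) * (pi / 2 * sgn (Z \<omega> + b * S \<omega>))"
      by (intro AE_I2 tendsto_mult Klim)
  qed auto
  also have "expectation (\<lambda>\<omega>. (pi / 2 * sgn (Z \<omega> - b * S \<omega>)) * (pi / 2 * sgn (Z \<omega> + b * S \<omega>)))
      = expectation (\<lambda>\<omega>. pi\<^sup>2 / 4 * (sgn (Z \<omega> - b * S \<omega>) * sgn (Z \<omega> + b * S \<omega>)))"
    by (intro Bochner_Integration.integral_cong) (auto simp: power2_eq_square)
  also have "\<dots> = pi\<^sup>2 / 4 * D" unfolding D_def by simp
  finally have lim: "(\<lambda>n. expectation (\<lambda>\<omega>. K n (Z \<omega> - b * S \<omega>) * K n (Z \<omega> + b * S \<omega>)))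
      \<longlonglongrightarrow> pi\<^sup>2 / 4 * D" .
  have "0 \<le> pi\<^sup>2 / 4 * D"
    by (rule LIMSEQ_le_const[OF lim]) (use trunc(1) in auto)
  then show "0 \<le> D" by (simp add: zero_le_mult_iff)
  let ?f = "\<lambda>n z. ennreal (H (fst z) (snd z)) * indicator {a n..c n} (fst z) * indicator {a n..c n} (snd z)"
  let ?g = "\<lambda>z. ennreal (H (fst z) (snd z)) * indicator {0<..} (fst z) * indicator {0<..} (snd z)"
  have "(\<lambda>n. \<integral>\<^sup>+z. ?f n z \<partial>(lborel \<Otimes>\<^sub>M lborel)) \<longlonglongrightarrow> (\<integral>\<^sup>+z. ?g z \<partial>(lborel \<Otimes>\<^sub>M lborel))"
  proof (rule nn_integral_LIMSEQ)
    have "{a m..c m} \<subseteq> {a n..c n}" if "m \<le> n" for m n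
      using that by (auto simp: a_def c_def frac_le intro: order_trans[rotated])
    then have "indicator {a m..c m} x \<le> (indicator {a n..c n} x :: ennreal)" if "m \<le> n" for m n x
      using that by (metis indicator_leI subsetD)
    then show "incseq ?f"
      by (auto simp: incseq_def le_fun_def intro!: mult_mono)
    have ind: "eventually (\<lambda>n. indicator {a n..c n} x = (indicator {0<..} x :: ennreal)) sequentially" for x
    proof (cases "0 < x")
      case True
      have "eventually (\<lambda>n. a n < x) sequentially" using order_tendstoD(2)[OF a0 True] .
      moreover have "eventually (\<lambda>n. x \<le> c n) sequentially" using cinf by (auto simp: filterlim_at_top)
      ultimately show ?thesis
        by eventually_elim (use True in auto)
    next
      case False
      then have "x \<notin> {a n..c n}" for n using ac(1)[of n] by auto
      then show ?thesis using False by simp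
    qed
    show "(\<lambda>n. ?f n z) \<longlonglongrightarrow> ?g z" for z
      using ind[of "fst z"] ind[of "snd z"]
      by (intro tendsto_eventually, eventually_elim) simp
  qed measurable
  also have "(\<lambda>n. \<integral>\<^sup>+z. ?f n z \<partial>(lborel \<Otimes>\<^sub>M lborel))
      = (\<lambda>n. ennreal (expectation (\<lambda>\<omega>. K n (Z \<omega> - b * S \<omega>) * K n (Z \<omega> + b * S \<omega>))))"
    unfolding trunc(2) by (subst lborel.nn_integral_fst[symmetric]) auto
  finally have lim2: "(\<lambda>n. ennreal (expectation (\<lambda>\<omega>. K n (Z \<omega> - b * S \<omega>) * K n (Z \<omega> + b * S \<omega>))))
      \<longlonglongrightarrow> (\<integral>\<^sup>+z. ?g z \<partial>(lborel \<Otimes>\<^sub>M lborel))" .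
  have "ennreal (pi\<^sup>2 / 4 * D) = (\<integral>\<^sup>+z. ?g z \<partial>(lborel \<Otimes>\<^sub>M lborel))"
    by (rule LIMSEQ_unique[OF tendsto_ennrealI[OF lim] lim2])
  also have "\<dots> = (\<integral>\<^sup>+u. \<integral>\<^sup>+v. ennreal (H u v) * indicator {0<..} u * indicator {0<..} v \<partial>lborel \<partial>lborel)"
    by (subst lborel.nn_integral_fst[symmetric]) auto
  also have "\<dots> = ennreal (2 / \<alpha>) *
      (\<integral>\<^sup>+m. ennreal (ln ((1 + b powr \<alpha> * m powr \<alpha>) / (m powr \<alpha> + b powr \<alpha>)) / (1 - m\<^sup>2))
        * indicator {0<..<1} m \<partial>lborel)"
    unfolding H_def using b \<alpha> powr_less_mono2[of \<alpha> b 1] by (intro nn_integral_sine_kernel) auto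
  finally show "ennreal (pi\<^sup>2 / 4 * D) = ennreal (2 / \<alpha>) *
      (\<integral>\<^sup>+m. ennreal (ln ((1 + b powr \<alpha> * m powr \<alpha>) / (m powr \<alpha> + b powr \<alpha>)) / (1 - m\<^sup>2))
        * indicator {0<..<1} m \<partial>lborel)" .
qed

section \<open>The distribution function of the absolute ratio: integral formula and bounds\<close>

text \<open>Averaging the strict and the weak distribution function makes \<open>1 - 2 * ratio_cdf b\<close> equal to
  \<open>E [sgn (Z - b S) sgn (Z + b S)]\<close> before atoms have been excluded.\<close>

definition ratio_cdf :: "real \<Rightarrow> real" where
  "ratio_cdf b = (\<P>(\<omega> in M. \<bar>Z \<omega>\<bar> < b * \<bar>S \<omega>\<bar>) + \<P>(\<omega> in M. \<bar>Z \<omega>\<bar> \<le> b * \<bar>S \<omega>\<bar>)) / 2"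

lemma expectation_sgn_sgn_eq_ratio_cdf:
  assumes "0 < b"
  shows "expectation (\<lambda>\<omega>. sgn (Z \<omega> - b * S \<omega>) * sgn (Z \<omega> + b * S \<omega>)) = 1 - 2 * ratio_cdf b"
proof -
  let ?le = "{\<omega> \<in> space M. \<bar>Z \<omega>\<bar> \<le> b * \<bar>S \<omega>\<bar>}" and ?lt = "{\<omega> \<in> space M. \<bar>Z \<omega>\<bar> < b * \<bar>S \<omega>\<bar>}"
  \<comment> \<open>The product is the sign of z^2 - b^2 s^2, hence 1, 0 or -1 according to whether
    |z| is above, equal to or below b |s|.\<close>
  have "sgn (z - b * s) * sgn (z + b * s) = 1 - of_bool (\<bar>z\<bar> \<le> b * \<bar>s\<bar>) - of_bool (\<bar>z\<bar> < b * \<bar>s\<bar>)" for z s :: real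
  proof -
    have "b * \<bar>s\<bar> = \<bar>b * s\<bar>" using assms by (simp add: abs_mult)
    then show ?thesis by (auto simp: sgn_real_def abs_if)
  qed
  then have "expectation (\<lambda>\<omega>. sgn (Z \<omega> - b * S \<omega>) * sgn (Z \<omega> + b * S \<omega>))
      = expectation (\<lambda>\<omega>. 1 - indicator ?le \<omega> - indicator ?lt \<omega>)"
    by (intro Bochner_Integration.integral_cong) (auto simp: indicator_def)
  also have "\<dots> = 1 - prob ?le - prob ?lt"
  proof -
    have "?le \<in> events" "?lt \<in> events" by measurable
    then have "integrable M (indicator ?le :: 'a \<Rightarrow> real)" "integrable M (indicator ?lt :: 'a \<Rightarrow> real)"
      by (auto intro!: integrable_real_indicator simp: less_top[symmetric])
    then show ?thesis
      using \<open>?le \<in> events\<close> \<open>?lt \<in> events\<close>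
      by (simp add: prob_space Int_absorb2 sets.sets_into_space)
  qed
  finally show ?thesis by (simp add: ratio_cdf_def field_simps)
qed

text \<open>With T = b^\<alpha> and q = m^\<alpha>, the arguments of the two logarithms multiply to
  1 / q, so the integrand of the sign correlation and the present one add up to - \<alpha> ln m / (1
  - m^2), with integral \<alpha> pi^2 / 8. The first part contributes \<alpha> pi^2 / 8 times
  \<open>1 - 2 * ratio_cdf b\<close>; subtracting this finite quantity leaves the claim.\<close>

lemma ratio_cdf_integral:
  assumes b: "0 < b" "b < 1"
  shows "ennreal (\<alpha> * pi\<^sup>2 / 4 * ratio_cdf b)
    = (\<integral>\<^sup>+m. ennreal (ln ((1 + b powr \<alpha> * m powr (-\<alpha>)) / (1 + b powr \<alpha> * m powr \<alpha>)) / (1 - m\<^sup>2))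
        * indicator {0<..<1} m \<partial>lborel)" (is "_ = ?Ih")
proof -
  let ?D = "1 - 2 * ratio_cdf b"
  let ?IL = "\<integral>\<^sup>+m. ennreal (ln ((1 + b powr \<alpha> * m powr \<alpha>) / (m powr \<alpha> + b powr \<alpha>)) / (1 - m\<^sup>2))
        * indicator {0<..<1} m \<partial>lborel"
  have D: "0 \<le> ?D" "ennreal (pi\<^sup>2 / 4 * ?D) = ennreal (2 / \<alpha>) * ?IL"
    using expectation_sgn_sgn[OF b] expectation_sgn_sgn_eq_ratio_cdf[OF b(1)] by auto
  have "ennreal (\<alpha> / 2) * ennreal (pi\<^sup>2 / 4 * ?D) = ?IL"
    unfolding D(2) using \<alpha> by (simp add: mult.assoc[symmetric] ennreal_mult'[symmetric])
  then have IL: "?IL = ennreal (\<alpha> * pi\<^sup>2 / 8 * ?D)"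
    using \<alpha> by (simp add: ennreal_mult'[symmetric] mult_ac)
  have "?IL + ?Ih = (\<integral>\<^sup>+m. ennreal \<alpha> * (ennreal (- ln m / (1 - m\<^sup>2)) * indicator {0<..<1} m) \<partial>lborel)"
  proof (subst nn_integral_add[symmetric], goal_cases)
    case 3
    show ?case
    proof (rule nn_integral_cong)
      fix m :: real
      let ?L = "ln ((1 + b powr \<alpha> * m powr \<alpha>) / (m powr \<alpha> + b powr \<alpha>))"
      let ?h = "ln ((1 + b powr \<alpha> * m powr (-\<alpha>)) / (1 + b powr \<alpha> * m powr \<alpha>))"
      show "ennreal (?L / (1 - m\<^sup>2)) * indicator {0<..<1} m + ennreal (?h / (1 - m\<^sup>2)) * indicator {0<..<1} m
        = ennreal \<alpha> * (ennreal (- ln m / (1 - m\<^sup>2)) * indicator {0<..<1} m)"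
      proof (cases "m \<in> {0<..<1}")
        case True
        define q T where "q = m powr \<alpha>" and "T = b powr \<alpha>"
        have q: "0 < q" "q < 1" and T: "0 < T" "T < 1"
          using True b \<alpha> powr_less_mono2[of \<alpha> m 1] powr_less_mono2[of \<alpha> b 1] by (auto simp: q_def T_def)
        have m2: "0 < 1 - m\<^sup>2" using True by (simp add: power_less_one_iff)
        have "0 \<le> (1 - T) * (1 - q)" using q T by simp
        then have le1: "q + T \<le> 1 + T * q" by (simp add: algebra_simps)
        have L: "0 \<le> ln ((1 + T * q) / (q + T))"
          using q T le1 by (intro ln_ge_zero) auto
        have inv: "m powr (-\<alpha>) = 1 / q" by (simp add: q_def powr_minus_divide)
        have "T * q \<le> T * (1 / q)" using q T by (intro mult_left_mono) (auto simp: field_simps mult_le_one)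
        then have h: "0 \<le> ln ((1 + T * (1 / q)) / (1 + T * q))"
          using q T by (intro ln_ge_zero) (auto simp: add_pos_pos)
        have "0 < 1 + T * q" "0 < q + T" using q T by (simp_all add: add_pos_pos)
        moreover have "1 + T * (1 / q) = (q + T) / q" using q by (simp add: field_simps)
        ultimately have "ln ((1 + T * q) / (q + T)) + ln ((1 + T * (1 / q)) / (1 + T * q)) = - ln q"
          using q T by (simp add: ln_div ln_mult)
        also have "\<dots> = \<alpha> * (- ln m)" using True by (simp add: q_def ln_powr)
        finally have sum: "ln ((1 + T * q) / (q + T)) / (1 - m\<^sup>2) + ln ((1 + T * (1 / q)) / (1 + T * q)) / (1 - m\<^sup>2)
            = \<alpha> * (- ln m / (1 - m\<^sup>2))"
          by (simp add: add_divide_distrib[symmetric])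
        have "ennreal (ln ((1 + T * q) / (q + T)) / (1 - m\<^sup>2)) + ennreal (ln ((1 + T * (1 / q)) / (1 + T * q)) / (1 - m\<^sup>2))
            = ennreal (\<alpha> * (- ln m / (1 - m\<^sup>2)))"
          unfolding sum[symmetric] using L h m2 by (intro ennreal_plus[symmetric]) auto
        also have "\<dots> = ennreal \<alpha> * ennreal (- ln m / (1 - m\<^sup>2))"
          using \<alpha> by (intro ennreal_mult') auto
        finally show ?thesis using True by (simp add: inv q_def T_def)
      qed simp
    qed
  qed measurable
  also have "\<dots> = ennreal \<alpha> * ennreal (pi\<^sup>2 / 8)"
    by (subst nn_integral_cmult) (measurable, simp only: nn_integral_neg_ln_weight)
  also have "\<dots> = ennreal (\<alpha> * pi\<^sup>2 / 8)"
    using \<alpha> by (simp add: ennreal_mult'[symmetric])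
  finally have "ennreal (\<alpha> * pi\<^sup>2 / 8) - ennreal (\<alpha> * pi\<^sup>2 / 8 * ?D)
      = ennreal (\<alpha> * pi\<^sup>2 / 8 * ?D) + ?Ih - ennreal (\<alpha> * pi\<^sup>2 / 8 * ?D)"
    by (simp only: IL)
  also have "\<dots> = ?Ih"
    by (rule ennreal_add_diff_cancel_left) (rule ennreal_neq_top)
  finally have "?Ih = ennreal (\<alpha> * pi\<^sup>2 / 8) - ennreal (\<alpha> * pi\<^sup>2 / 8 * ?D)" by (rule sym)
  also have "\<dots> = ennreal (\<alpha> * pi\<^sup>2 / 8 - \<alpha> * pi\<^sup>2 / 8 * ?D)"
    using D(1) \<alpha> by (intro ennreal_minus) auto
  also have "\<alpha> * pi\<^sup>2 / 8 - \<alpha> * pi\<^sup>2 / 8 * ?D = \<alpha> * pi\<^sup>2 / 4 * ratio_cdf b"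
    by (simp add: field_simps)
  finally show ?thesis by simp
qed

lemma ratio_cdf_nonneg: "0 \<le> ratio_cdf b"
  by (simp add: ratio_cdf_def)

text \<open>The integrand of \<open>ratio_cdf_integral\<close> is concave in \<open>T = b\<^sup>\<alpha>\<close> and vanishes at \<open>T = 0\<close>.\<close>

lemma ratio_cdf_star_shaped:
  assumes "0 < a" "a \<le> b" "b < 1"
  shows "(a / b) powr \<alpha> * ratio_cdf b \<le> ratio_cdf a"
proof -
  define t where "t = (a / b) powr \<alpha>"
  have t: "0 \<le> t" "t \<le> 1"
    using assms \<alpha> by (auto simp: t_def intro!: powr_le1)
  have ta: "a powr \<alpha> = t * b powr \<alpha>"
    using assms by (simp add: t_def powr_divide)
  let ?h = "\<lambda>T m. ln ((1 + T * m powr (-\<alpha>)) / (1 + T * m powr \<alpha>))"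
  have "ennreal (t * (\<alpha> * pi\<^sup>2 / 4 * ratio_cdf b)) = ennreal t * ennreal (\<alpha> * pi\<^sup>2 / 4 * ratio_cdf b)"
    by (rule ennreal_mult'[OF t(1)])
  also have "\<dots> = (\<integral>\<^sup>+m. ennreal t * (ennreal (?h (b powr \<alpha>) m / (1 - m\<^sup>2)) * indicator {0<..<1} m) \<partial>lborel)"
    using assms by (subst ratio_cdf_integral) (auto simp: nn_integral_cmult)
  also have "\<dots> \<le> (\<integral>\<^sup>+m. ennreal (?h (a powr \<alpha>) m / (1 - m\<^sup>2)) * indicator {0<..<1} m \<partial>lborel)"
  proof (rule nn_integral_mono)
    fix m :: real
    show "ennreal t * (ennreal (?h (b powr \<alpha>) m / (1 - m\<^sup>2)) * indicator {0<..<1} m)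
        \<le> ennreal (?h (a powr \<alpha>) m / (1 - m\<^sup>2)) * indicator {0<..<1} m"
    proof (cases "m \<in> {0<..<1}")
      case True
      have "b powr \<alpha> * m powr \<alpha> \<le> b powr \<alpha> * m powr (-\<alpha>)"
        using True \<alpha> by (intro mult_left_mono powr_mono') auto
      then have "t * ?h (b powr \<alpha>) m \<le> ?h (a powr \<alpha>) m"
        using ln_ratio_concave[of "b powr \<alpha> * m powr \<alpha>" "b powr \<alpha> * m powr (-\<alpha>)" t] t
        by (simp add: ta mult.assoc)
      moreover have "0 < 1 - m\<^sup>2" using True by (simp add: power_less_one_iff)
      ultimately have "t * ?h (b powr \<alpha>) m / (1 - m\<^sup>2) \<le> ?h (a powr \<alpha>) m / (1 - m\<^sup>2)"
        by (intro divide_right_mono) auto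
      then show ?thesis
        using True t by (simp add: ennreal_mult'[symmetric] ennreal_leI)
    qed simp
  qed
  also have "\<dots> = ennreal (\<alpha> * pi\<^sup>2 / 4 * ratio_cdf a)"
    using assms by (subst ratio_cdf_integral) auto
  finally have "t * (\<alpha> * pi\<^sup>2 / 4 * ratio_cdf b) \<le> \<alpha> * pi\<^sup>2 / 4 * ratio_cdf a"
    using \<alpha> ratio_cdf_nonneg by (subst (asm) ennreal_le_iff) auto
  then have "(\<alpha> * pi\<^sup>2 / 4) * (t * ratio_cdf b) \<le> (\<alpha> * pi\<^sup>2 / 4) * ratio_cdf a"
    by (simp add: mult_ac)
  then show ?thesis
    using \<alpha> unfolding t_def by (subst (asm) mult_le_cancel_left_pos) auto
qed

text \<open>Linearising the logarithm bounds the integral by b^\<alpha> times 2 \<alpha> / (1 -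
  \<alpha>^2) * pi^2 / 8, and division by \<alpha> pi^2 / 4 leaves b^\<alpha> / (1 -
  \<alpha>^2).\<close>

lemma ratio_cdf_le:
  assumes "0 < b" "b < 1"
  shows "ratio_cdf b \<le> b powr \<alpha> / (1 - \<alpha>\<^sup>2)"
proof -
  have a2: "0 < 1 - \<alpha>\<^sup>2" using \<alpha> by (simp add: power_less_one_iff)
  have "ennreal (\<alpha> * pi\<^sup>2 / 4 * ratio_cdf b)
    \<le> (\<integral>\<^sup>+m. ennreal (b powr \<alpha>) * (ennreal ((m powr (-\<alpha>) - m powr \<alpha>) / (1 - m\<^sup>2)) * indicator {0<..<1} m) \<partial>lborel)"
    unfolding ratio_cdf_integral[OF assms]
  proof (rule nn_integral_mono)
    fix m :: real
    show "ennreal (ln ((1 + b powr \<alpha> * m powr (-\<alpha>)) / (1 + b powr \<alpha> * m powr \<alpha>)) / (1 - m\<^sup>2)) * indicator {0<..<1} m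
      \<le> ennreal (b powr \<alpha>) * (ennreal ((m powr (-\<alpha>) - m powr \<alpha>) / (1 - m\<^sup>2)) * indicator {0<..<1} m)"
    proof (cases "m \<in> {0<..<1}")
      case True
      have "b powr \<alpha> * m powr \<alpha> \<le> b powr \<alpha> * m powr (-\<alpha>)"
        using True \<alpha> by (intro mult_left_mono powr_mono') auto
      then have "ln ((1 + b powr \<alpha> * m powr (-\<alpha>)) / (1 + b powr \<alpha> * m powr \<alpha>))
          \<le> b powr \<alpha> * (m powr (-\<alpha>) - m powr \<alpha>)"
        using ln_ratio_le_diff[of "b powr \<alpha> * m powr \<alpha>" "b powr \<alpha> * m powr (-\<alpha>)"]
        by (simp add: right_diff_distrib)
      moreover have "0 < 1 - m\<^sup>2" using True by (simp add: power_less_one_iff)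
      ultimately have "ln ((1 + b powr \<alpha> * m powr (-\<alpha>)) / (1 + b powr \<alpha> * m powr \<alpha>)) / (1 - m\<^sup>2)
          \<le> b powr \<alpha> * (m powr (-\<alpha>) - m powr \<alpha>) / (1 - m\<^sup>2)"
        by (intro divide_right_mono) auto
      then show ?thesis
        using True by (simp add: ennreal_mult'[symmetric] ennreal_leI)
    qed simp
  qed
  also have "\<dots> = ennreal (b powr \<alpha>) * (\<integral>\<^sup>+m. ennreal ((m powr (-\<alpha>) - m powr \<alpha>) / (1 - m\<^sup>2)) * indicator {0<..<1} m \<partial>lborel)"
    by (rule nn_integral_cmult) measurable
  also have "\<dots> \<le> ennreal (b powr \<alpha>) * ennreal (2 * \<alpha> / (1 - \<alpha>\<^sup>2) * (pi\<^sup>2 / 8))"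
    using \<alpha> by (intro mult_left_mono nn_integral_powr_diff_weight_le) auto
  also have "\<dots> = ennreal (b powr \<alpha> * (2 * \<alpha> / (1 - \<alpha>\<^sup>2) * (pi\<^sup>2 / 8)))"
    by (rule ennreal_mult'[symmetric]) simp
  finally have "\<alpha> * pi\<^sup>2 / 4 * ratio_cdf b \<le> b powr \<alpha> * (2 * \<alpha> / (1 - \<alpha>\<^sup>2) * (pi\<^sup>2 / 8))"
    using \<alpha> a2 by (subst (asm) ennreal_le_iff) auto
  also have "\<dots> = (\<alpha> * pi\<^sup>2 / 4) * (b powr \<alpha> / (1 - \<alpha>\<^sup>2))"
    using a2 by (simp add: field_simps)
  finally show ?thesis
    using \<alpha> by (subst (asm) mult_le_cancel_left_pos) auto
qed

section \<open>Null events, and the probability that the absolute ratio lies in a band\<close>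

text \<open>The event is contained in |Z| \<le> b |S| for every b, and that probability is at most
  \<open>2 * ratio_cdf b\<close>, which tends to 0 with b.\<close>

lemma prob_both_zero: "\<P>(\<omega> in M. S \<omega> = 0 \<and> Z \<omega> = 0) = 0"
proof -
  have le: "\<P>(\<omega> in M. S \<omega> = 0 \<and> Z \<omega> = 0) \<le> 2 * (b powr \<alpha> / (1 - \<alpha>\<^sup>2))" if "0 < b" "b < 1" for b
  proof -
    have "\<P>(\<omega> in M. S \<omega> = 0 \<and> Z \<omega> = 0) \<le> \<P>(\<omega> in M. \<bar>Z \<omega>\<bar> \<le> b * \<bar>S \<omega>\<bar>)"
      by (intro finite_measure_mono) auto
    also have "\<dots> \<le> 2 * ratio_cdf b"
      by (simp add: ratio_cdf_def)
    also have "\<dots> \<le> 2 * (b powr \<alpha> / (1 - \<alpha>\<^sup>2))"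
      using ratio_cdf_le[OF that] by simp
    finally show ?thesis .
  qed
  have "((\<lambda>b. 2 * (b powr \<alpha> / (1 - \<alpha>\<^sup>2))) \<longlongrightarrow> 2 * (0 / (1 - \<alpha>\<^sup>2))) (at_right 0)"
  proof (intro tendsto_intros)
    show "((\<lambda>b. b powr \<alpha>) \<longlongrightarrow> 0) (at_right 0)" using \<alpha> by real_asymp
    show "1 - \<alpha>\<^sup>2 \<noteq> 0" using \<alpha> by (simp add: power_less_one_iff less_imp_neq)
  qed
  moreover have "eventually (\<lambda>b. \<P>(\<omega> in M. S \<omega> = 0 \<and> Z \<omega> = 0) \<le> 2 * (b powr \<alpha> / (1 - \<alpha>\<^sup>2))) (at_right 0)"
    using eventually_at_right_real[OF zero_less_one] by (rule eventually_mono) (intro le; simp)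
  ultimately have "\<P>(\<omega> in M. S \<omega> = 0 \<and> Z \<omega> = 0) \<le> 2 * (0 / (1 - \<alpha>\<^sup>2))"
    by (intro tendsto_lowerbound) auto
  then show ?thesis
    by (simp add: measure_le_0_iff)
qed

text \<open>Where S is nonzero the weak inequality for \<open>a\<close> implies the strict one for
  \<open>b\<close>; where S = 0 it forces Z = 0, a null event. Weak and strict bounds can thus be
  exchanged by moving the threshold slightly.\<close>

lemma prob_ratio_le_prob_ratio_less:
  assumes "a < b"
  shows "\<P>(\<omega> in M. \<bar>Z \<omega>\<bar> \<le> a * \<bar>S \<omega>\<bar>) \<le> \<P>(\<omega> in M. \<bar>Z \<omega>\<bar> < b * \<bar>S \<omega>\<bar>)"
proof -
  have "\<P>(\<omega> in M. \<bar>Z \<omega>\<bar> \<le> a * \<bar>S \<omega>\<bar>)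
      \<le> prob ({\<omega> \<in> space M. \<bar>Z \<omega>\<bar> < b * \<bar>S \<omega>\<bar>} \<union> {\<omega> \<in> space M. S \<omega> = 0 \<and> Z \<omega> = 0})"
  proof (rule finite_measure_mono)
    have "\<bar>z\<bar> < b * \<bar>s\<bar> \<or> s = 0 \<and> z = 0" if "\<bar>z\<bar> \<le> a * \<bar>s\<bar>" for z s :: real
    proof (cases "s = 0")
      case False
      then have "a * \<bar>s\<bar> < b * \<bar>s\<bar>" using assms by simp
      then show ?thesis using that by simp
    qed (use that in simp)
    then show "{\<omega> \<in> space M. \<bar>Z \<omega>\<bar> \<le> a * \<bar>S \<omega>\<bar>}
      \<subseteq> {\<omega> \<in> space M. \<bar>Z \<omega>\<bar> < b * \<bar>S \<omega>\<bar>} \<union> {\<omega> \<in> space M. S \<omega> = 0 \<and> Z \<omega> = 0}"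
      by auto
  qed measurable
  also have "\<dots> \<le> \<P>(\<omega> in M. \<bar>Z \<omega>\<bar> < b * \<bar>S \<omega>\<bar>) + \<P>(\<omega> in M. S \<omega> = 0 \<and> Z \<omega> = 0)"
    by (intro measure_Un_le) auto
  finally show ?thesis by (simp add: prob_both_zero)
qed

lemma ratio_cdf_bounds:
  "\<P>(\<omega> in M. \<bar>Z \<omega>\<bar> < b * \<bar>S \<omega>\<bar>) \<le> ratio_cdf b" "ratio_cdf b \<le> \<P>(\<omega> in M. \<bar>Z \<omega>\<bar> \<le> b * \<bar>S \<omega>\<bar>)"
proof -
  have "\<P>(\<omega> in M. \<bar>Z \<omega>\<bar> < b * \<bar>S \<omega>\<bar>) \<le> \<P>(\<omega> in M. \<bar>Z \<omega>\<bar> \<le> b * \<bar>S \<omega>\<bar>)"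
    by (intro finite_measure_mono) auto
  then show "\<P>(\<omega> in M. \<bar>Z \<omega>\<bar> < b * \<bar>S \<omega>\<bar>) \<le> ratio_cdf b" "ratio_cdf b \<le> \<P>(\<omega> in M. \<bar>Z \<omega>\<bar> \<le> b * \<bar>S \<omega>\<bar>)"
    by (simp_all add: ratio_cdf_def field_simps)
qed

text \<open>The band is closed, while \<open>ratio_cdf\<close> gives possible atoms at its ends only
  half their weight. The band is therefore widened to thresholds \<open>a * d\<close> and
  \<open>b / d\<close> with d < 1, the estimate of \<open>ratio_cdf\<close> is applied there, and d
  tends to 1. The condition b < d keeps \<open>b / d\<close> below 1.\<close>

lemma prob_ratio_band_le:
  assumes "0 < a" "a \<le> b" "b < 1"
  shows "\<P>(\<omega> in M. a * \<bar>S \<omega>\<bar> \<le> \<bar>Z \<omega>\<bar> \<and> \<bar>Z \<omega>\<bar> \<le> b * \<bar>S \<omega>\<bar>)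
    \<le> b powr \<alpha> / (1 - \<alpha>\<^sup>2) * (1 - (a / b) powr \<alpha>)" (is "?P \<le> _")
proof -
  have a2: "0 < 1 - \<alpha>\<^sup>2" using \<alpha> by (simp add: power_less_one_iff)
  define f where "f d = (b / d) powr \<alpha> / (1 - \<alpha>\<^sup>2) * (1 - (a * d / (b / d)) powr \<alpha>)" for d
  have bound: "?P \<le> f d" if d: "b < d" "d < 1" for d
  proof -
    have d0: "0 < d" using assms d by simp
    have b': "b < b / d" "b / d < 1" and a': "0 < a * d" "a * d < a"
      using assms d d0 by (auto simp: field_simps)
    have ab: "a * d \<le> b / d" using assms a' b' by linarith
    have "?P + \<P>(\<omega> in M. \<bar>Z \<omega>\<bar> < a * \<bar>S \<omega>\<bar>) = prob ({\<omega> \<in> space M. a * \<bar>S \<omega>\<bar> \<le> \<bar>Z \<omega>\<bar> \<and> \<bar>Z \<omega>\<bar> \<le> b * \<bar>S \<omega>\<bar>}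
        \<union> {\<omega> \<in> space M. \<bar>Z \<omega>\<bar> < a * \<bar>S \<omega>\<bar>})"
      by (intro finite_measure_Union[symmetric]) auto
    also have "\<dots> \<le> \<P>(\<omega> in M. \<bar>Z \<omega>\<bar> \<le> b * \<bar>S \<omega>\<bar>)"
    proof (rule finite_measure_mono)
      have "\<bar>z\<bar> \<le> b * \<bar>s\<bar>" if "\<bar>z\<bar> < a * \<bar>s\<bar>" for z s :: real
        using that mult_right_mono[of a b "\<bar>s\<bar>"] assms by linarith
      then show "{\<omega> \<in> space M. a * \<bar>S \<omega>\<bar> \<le> \<bar>Z \<omega>\<bar> \<and> \<bar>Z \<omega>\<bar> \<le> b * \<bar>S \<omega>\<bar>}
        \<union> {\<omega> \<in> space M. \<bar>Z \<omega>\<bar> < a * \<bar>S \<omega>\<bar>} \<subseteq> {\<omega> \<in> space M. \<bar>Z \<omega>\<bar> \<le> b * \<bar>S \<omega>\<bar>}"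
        by blast
    qed measurable
    finally have 1: "?P \<le> \<P>(\<omega> in M. \<bar>Z \<omega>\<bar> \<le> b * \<bar>S \<omega>\<bar>) - \<P>(\<omega> in M. \<bar>Z \<omega>\<bar> < a * \<bar>S \<omega>\<bar>)" by simp
    have "?P \<le> ratio_cdf (b / d) - ratio_cdf (a * d)"
      using 1 prob_ratio_le_prob_ratio_less[OF b'(1)] prob_ratio_le_prob_ratio_less[OF a'(2)]
        ratio_cdf_bounds(1)[of "b / d"] ratio_cdf_bounds(2)[of "a * d"]
      by linarith
    also have "\<dots> \<le> ratio_cdf (b / d) * (1 - (a * d / (b / d)) powr \<alpha>)"
      using ratio_cdf_star_shaped[OF a'(1) ab b'(2)] by (simp add: algebra_simps)
    also have "\<dots> \<le> f d"
    proof -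
      have "a * d * d \<le> b" using ab d0 by (simp add: pos_le_divide_eq)
      then have "(a * d / (b / d)) powr \<alpha> \<le> 1"
        using assms d0 \<alpha> by (intro powr_le1) (auto simp: divide_le_eq_1)
      then show ?thesis
        unfolding f_def using assms b' d0 by (intro mult_right_mono ratio_cdf_le) auto
    qed
    finally show ?thesis .
  qed
  have "((\<lambda>d. f d) \<longlongrightarrow> f 1) (at_left 1)"
  proof -
    have "isCont f 1" unfolding f_def using assms a2 by (intro continuous_intros) auto
    then show ?thesis
      using tendsto_mono[OF at_le[of "{..<1}" UNIV 1]] by (auto simp: isCont_def)
  qed
  moreover have "eventually (\<lambda>d. ?P \<le> f d) (at_left 1)"
    using eventually_at_left_real[OF assms(3)] by eventually_elim (use bound in auto)
  ultimately have "?P \<le> f 1"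
    by (intro tendsto_lowerbound) auto
  then show ?thesis by (simp add: f_def)
qed

text \<open>By uniqueness of characteristic functions S and Z have the same law, so independence
  makes the probability of S = Z = 0 the square of that of S = 0.\<close>

lemma prob_S_zero: "\<P>(\<omega> in M. S \<omega> = 0) = 0"
proof -
  have "distr M borel S = distr M borel Z"
    by (rule Levy_uniqueness) (auto simp: char_S char_Z fun_eq_iff real_distribution_distr)
  then have "measure (distr M borel S) {0} = measure (distr M borel Z) {0}" by simp
  then have eq: "\<P>(\<omega> in M. S \<omega> = 0) = \<P>(\<omega> in M. Z \<omega> = 0)"
    by (simp add: measure_distr vimage_def Int_def conj_commute)
  have "\<P>(\<omega> in M. S \<omega> \<in> {0} \<and> Z \<omega> \<in> {0}) = \<P>(\<omega> in M. S \<omega> \<in> {0}) * \<P>(\<omega> in M. Z \<omega> \<in> {0})"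
    by (rule prob_indep_random_variable[OF indep]) auto
  then show ?thesis
    using prob_both_zero eq by simp
qed

section \<open>Reflection of S and the bound for a shifted ratio\<close>

text \<open>The characteristic function is even, so -S has the law of S, and by independence the
  joint law with Z is the same product measure.\<close>

lemma prob_reflect:
  assumes [measurable]: "A \<in> sets (borel \<Otimes>\<^sub>M borel)"
  shows "\<P>(\<omega> in M. (- S \<omega>, Z \<omega>) \<in> A) = \<P>(\<omega> in M. (S \<omega>, Z \<omega>) \<in> A)"
proof -
  have "char (distr M borel (\<lambda>\<omega>. - S \<omega>)) t = char (distr M borel S) (- t)" for t
    by (simp add: char_def integral_distr)
  then have eq: "distr M borel (\<lambda>\<omega>. - S \<omega>) = distr M borel S"
    by (intro Levy_uniqueness) (auto simp: char_S fun_eq_iff real_distribution_distr)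
  have "indep_var borel (\<lambda>\<omega>. - S \<omega>) borel Z"
    using indep_var_compose[OF indep, of uminus borel "\<lambda>x. x" borel] by (simp add: comp_def)
  then have "distr M (borel \<Otimes>\<^sub>M borel) (\<lambda>\<omega>. (- S \<omega>, Z \<omega>)) = distr M borel (\<lambda>\<omega>. - S \<omega>) \<Otimes>\<^sub>M distr M borel Z"
    by (simp add: indep_var_distribution_eq)
  also have "\<dots> = distr M (borel \<Otimes>\<^sub>M borel) (\<lambda>\<omega>. (S \<omega>, Z \<omega>))"
    using indep by (simp add: indep_var_distribution_eq eq)
  finally have "measure (distr M (borel \<Otimes>\<^sub>M borel) (\<lambda>\<omega>. (- S \<omega>, Z \<omega>))) A
      = measure (distr M (borel \<Otimes>\<^sub>M borel) (\<lambda>\<omega>. (S \<omega>, Z \<omega>))) A" by simp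
  then show ?thesis
    by (simp add: measure_distr vimage_def Int_def conj_commute)
qed

text \<open>The events for \<open>x\<close> and \<open>- x\<close> are equally likely by reflection,
  both lie in the band with ends \<open>a\<close> and \<open>b\<close>, and they meet only where S =
  Z = 0. So each has at most half the probability of the band, whence the 2 in the
  denominator.\<close>

lemma prob_shifted_ratio_le:
  assumes x: "0 < \<epsilon>" "\<epsilon> < \<bar>x\<bar>" and \<theta>: "0 < \<theta>" "(\<bar>x\<bar> + \<epsilon>) / \<theta> < 1"
  shows "\<P>(\<omega> in M. \<bar>(x * S \<omega> + \<theta> * Z \<omega>) / S \<omega>\<bar> \<le> \<epsilon>)
    \<le> ((\<bar>x\<bar> + \<epsilon>) / \<theta>) powr \<alpha> / (2 * (1 - \<alpha>\<^sup>2)) * (1 - ((\<bar>x\<bar> - \<epsilon>) / (\<bar>x\<bar> + \<epsilon>)) powr \<alpha>)"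
proof -
  define a b where "a = (\<bar>x\<bar> - \<epsilon>) / \<theta>" and "b = (\<bar>x\<bar> + \<epsilon>) / \<theta>"
  have ab: "0 < a" "a \<le> b" "b < 1" "a / b = (\<bar>x\<bar> - \<epsilon>) / (\<bar>x\<bar> + \<epsilon>)"
    using x \<theta> by (auto simp: a_def b_def divide_right_mono)
  let ?E = "\<lambda>x. {\<omega> \<in> space M. \<bar>x * S \<omega> + \<theta> * Z \<omega>\<bar> \<le> \<epsilon> * \<bar>S \<omega>\<bar>}"
  let ?O = "{\<omega> \<in> space M. S \<omega> = 0 \<and> Z \<omega> = 0}"
  let ?B = "{\<omega> \<in> space M. a * \<bar>S \<omega>\<bar> \<le> \<bar>Z \<omega>\<bar> \<and> \<bar>Z \<omega>\<bar> \<le> b * \<bar>S \<omega>\<bar>}"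
  have sym: "prob (?E (- x)) = prob (?E x)"
  proof -
    have "{p \<in> space (borel \<Otimes>\<^sub>M borel). \<bar>x * fst p + \<theta> * snd p\<bar> \<le> \<epsilon> * \<bar>fst p\<bar>} \<in> sets (borel \<Otimes>\<^sub>M borel)"
      by measurable
    from prob_reflect[OF this] show ?thesis by (simp add: space_pair_measure)
  qed
  have sub: "?E y \<subseteq> ?B" if "\<bar>y\<bar> = \<bar>x\<bar>" for y
  proof -
    have "a * \<bar>s\<bar> \<le> \<bar>z\<bar> \<and> \<bar>z\<bar> \<le> b * \<bar>s\<bar>" if "\<bar>y * s + \<theta> * z\<bar> \<le> \<epsilon> * \<bar>s\<bar>" for s z
    proof -
      have "\<bar>y * s\<bar> = \<bar>x\<bar> * \<bar>s\<bar>" "\<bar>\<theta> * z\<bar> = \<theta> * \<bar>z\<bar>"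
        using \<open>\<bar>y\<bar> = \<bar>x\<bar>\<close> \<theta> by (auto simp: abs_mult)
      then have "(\<bar>x\<bar> - \<epsilon>) * \<bar>s\<bar> \<le> \<theta> * \<bar>z\<bar>" "\<theta> * \<bar>z\<bar> \<le> (\<bar>x\<bar> + \<epsilon>) * \<bar>s\<bar>"
        unfolding left_diff_distrib distrib_right using that by linarith+
      then show ?thesis using \<theta> by (simp add: a_def b_def field_simps)
    qed
    then show ?thesis by blast
  qed
  have inter: "?E x \<inter> ?E (- x) \<subseteq> ?O"
  proof -
    have "s = 0 \<and> z = 0" if "\<bar>x * s + \<theta> * z\<bar> \<le> \<epsilon> * \<bar>s\<bar>" "\<bar>- x * s + \<theta> * z\<bar> \<le> \<epsilon> * \<bar>s\<bar>" for s z
    proof -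
      have "2 * \<bar>x * s\<bar> \<le> 2 * (\<epsilon> * \<bar>s\<bar>)" using that by linarith
      then have "(\<bar>x\<bar> - \<epsilon>) * \<bar>s\<bar> \<le> 0" by (simp add: abs_mult algebra_simps)
      then have "s = 0" using x by (simp add: mult_le_0_iff)
      then show ?thesis using that \<theta> by simp
    qed
    then show ?thesis by blast
  qed
  have meas[measurable]: "?E y \<in> events" for y by measurable
  have "prob (?E x \<inter> ?E (- x)) \<le> prob ?O"
    by (rule finite_measure_mono[OF inter]) measurable
  then have "prob (?E x \<inter> ?E (- x)) = 0"
    by (simp add: prob_both_zero measure_le_0_iff)
  then have "2 * prob (?E x) = prob (?E x \<union> ?E (- x))"
    using measure_Un3[of "?E x" M "?E (- x)"] sym by (simp add: fmeasurable_eq_sets)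
  also have "\<dots> \<le> prob ?B"
    using sub[of x] sub[of "- x"] by (intro finite_measure_mono) auto
  also have "\<dots> \<le> b powr \<alpha> / (1 - \<alpha>\<^sup>2) * (1 - (a / b) powr \<alpha>)"
    by (rule prob_ratio_band_le[OF ab(1-3)])
  finally have two: "2 * prob (?E x) \<le> b powr \<alpha> / (1 - \<alpha>\<^sup>2) * (1 - (a / b) powr \<alpha>)" .
  have half: "p \<le> q / 2" if "2 * p \<le> q" for p q :: real using that by simp
  have "u / v * t / 2 = u / (2 * v) * t" for u v t :: real by simp
  with half[OF two] have E: "prob (?E x) \<le> b powr \<alpha> / (2 * (1 - \<alpha>\<^sup>2)) * (1 - (a / b) powr \<alpha>)"
    by (simp only:)
  \<comment> \<open>Division by zero gives 0, so all of S = 0 belongs to the event on the left; it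
    is added as a null event.\<close>
  have "\<P>(\<omega> in M. \<bar>(x * S \<omega> + \<theta> * Z \<omega>) / S \<omega>\<bar> \<le> \<epsilon>) \<le> prob (?E x \<union> {\<omega> \<in> space M. S \<omega> = 0})"
    by (rule finite_measure_mono) (auto simp: abs_divide field_simps)
  also have "\<dots> \<le> prob (?E x) + \<P>(\<omega> in M. S \<omega> = 0)"
    by (intro measure_Un_le) auto
  also have "\<dots> \<le> b powr \<alpha> / (2 * (1 - \<alpha>\<^sup>2)) * (1 - (a / b) powr \<alpha>)"
    using E by (simp only: prob_S_zero add_0_right)
  finally show ?thesis by (simp only: ab(4)) (simp only: b_def)
qed

end

section \<open>The minimum estimator\<close>

text \<open>Stability: the factors exp (- |w_k t|^\<alpha>) multiply to exp (- |t|^\<alpha>) because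
  the |w_k|^\<alpha> sum to 1. The sum is independent of \<open>s i\<close> as it involves only
  indices in \<open>K\<close>.\<close>

lemma iid_stable_pair_sum:
  fixes s :: "'i \<Rightarrow> 'a \<Rightarrow> real" and w :: "'i \<Rightarrow> real"
  assumes "prob_space M" and \<alpha>: "0 < \<alpha>" "\<alpha> < 1" and K: "finite K" "i \<notin> K"
    and indep: "prob_space.indep_vars M (\<lambda>_. borel) s (insert i K)"
    and char: "\<And>k t. k \<in> insert i K \<Longrightarrow> char (distr M borel (s k)) t = complex_of_real (exp (- (\<bar>t\<bar> powr \<alpha>)))"
    and w: "(\<Sum>k\<in>K. \<bar>w k\<bar> powr \<alpha>) = 1"
  shows "iid_stable_pair M (s i) (\<lambda>\<omega>. \<Sum>k\<in>K. w k * s k \<omega>) \<alpha>"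
proof -
  interpret prob_space M by fact
  \<comment> \<open>Giving index \<open>i\<close> the weight 1 puts \<open>s i\<close> and all
    weighted summands into one independent family.\<close>
  define v where "v = w(i := 1)"
  have v: "v i = 1" "\<And>k. k \<in> K \<Longrightarrow> v k = w k" using K by (auto simp: v_def)
  have s: "random_variable borel (s k)" if "k \<in> insert i K" for k
    using indep that by (auto simp: indep_vars_def)
  have ind: "indep_vars (\<lambda>_. borel) (\<lambda>k \<omega>. v k * s k \<omega>) (insert i K)"
    by (rule indep_vars_compose2[OF indep]) auto
  have "indep_var borel (\<lambda>\<omega>. v i * s i \<omega>) borel (\<lambda>\<omega>. \<Sum>k\<in>K. v k * s k \<omega>)"
    by (rule indep_vars_sum[OF K ind])
  then have 1: "indep_var borel (s i) borel (\<lambda>\<omega>. \<Sum>k\<in>K. w k * s k \<omega>)"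
    using v by simp
  have 2: "char (distr M borel (\<lambda>\<omega>. \<Sum>k\<in>K. w k * s k \<omega>)) t = complex_of_real (exp (- (\<bar>t\<bar> powr \<alpha>)))" for t
  proof -
    have "char (distr M borel (\<lambda>\<omega>. \<Sum>k\<in>K. w k * s k \<omega>)) t
        = char (distr M borel (\<lambda>\<omega>. \<Sum>k\<in>K. v k * s k \<omega>)) t"
      using v by simp
    also have "\<dots> = (\<Prod>k\<in>K. char (distr M borel (\<lambda>\<omega>. v k * s k \<omega>)) t)"
      by (rule char_distr_sum) (rule indep_vars_subset[OF ind], auto)
    also have "\<dots> = (\<Prod>k\<in>K. complex_of_real (exp (- (\<bar>w k\<bar> powr \<alpha> * \<bar>t\<bar> powr \<alpha>))))"
    proof (rule prod.cong[OF refl])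
      fix k assume k: "k \<in> K"
      have "char (distr M borel (\<lambda>\<omega>. v k * s k \<omega>)) t = char (distr M borel (s k)) (w k * t)"
        using s[of k] k v by (simp add: char_def integral_distr mult_ac)
      then show "char (distr M borel (\<lambda>\<omega>. v k * s k \<omega>)) t = complex_of_real (exp (- (\<bar>w k\<bar> powr \<alpha> * \<bar>t\<bar> powr \<alpha>)))"
        using char[of k "w k * t"] k by (simp add: abs_mult powr_mult)
    qed
    also have "\<dots> = complex_of_real (exp (\<Sum>k\<in>K. - (\<bar>w k\<bar> powr \<alpha> * \<bar>t\<bar> powr \<alpha>)))"
      using K by (simp only: exp_sum of_real_prod)
    also have "(\<Sum>k\<in>K. - (\<bar>w k\<bar> powr \<alpha> * \<bar>t\<bar> powr \<alpha>)) = - (\<bar>t\<bar> powr \<alpha>)"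
      using w by (simp add: sum_negf sum_distrib_right[symmetric])
    finally show ?thesis .
  qed
  show ?thesis
    by unfold_locales (use 1 2 char[of i] \<alpha> in auto)
qed

text \<open>By independence the complementary event has a product as its probability, with every
  factor at least 1 - p. Since p \<le> 1 this bound is nonnegative and the products can be
  compared.\<close>

lemma (in prob_space) prob_exists_le_of_indep:
  fixes Y :: "'i \<Rightarrow> 'a \<Rightarrow> 'b"
  assumes indep: "indep_vars (\<lambda>_. N) Y J" and J: "finite J" "J \<noteq> {}" and B: "B \<in> sets N"
    and p: "\<And>j. j \<in> J \<Longrightarrow> \<P>(\<omega> in M. Y j \<omega> \<in> B) \<le> p" "p \<le> 1"
  shows "\<P>(\<omega> in M. \<exists>j\<in>J. Y j \<omega> \<in> B) \<le> 1 - (1 - p) ^ card J"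
proof -
  have Y[measurable]: "Y j \<in> measurable M N" if "j \<in> J" for j
    using indep that by (auto simp: indep_vars_def)
  have ev: "Y j -` B \<inter> space M \<in> events" if "j \<in> J" for j
    using Y[OF that] B by (rule measurable_sets)
  have compl: "prob (Y j -` (space N - B) \<inter> space M) = 1 - \<P>(\<omega> in M. Y j \<omega> \<in> B)" if "j \<in> J" for j
  proof -
    have "Y j -` (space N - B) \<inter> space M = space M - (Y j -` B \<inter> space M)"
      using measurable_space[OF Y[OF that]] by auto
    moreover have "Y j -` B \<inter> space M = {\<omega> \<in> space M. Y j \<omega> \<in> B}" by auto
    ultimately show ?thesis using prob_compl[OF ev[OF that]] by simp
  qed
  have "(1 - p) ^ card J = (\<Prod>j\<in>J. 1 - p)" by simp
  also have "\<dots> \<le> (\<Prod>j\<in>J. prob (Y j -` (space N - B) \<inter> space M))"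
    using p by (intro prod_mono) (auto simp: compl)
  also have "\<dots> = prob (\<Inter>j\<in>J. Y j -` (space N - B) \<inter> space M)"
    using J B by (intro indep_varsD_finite[OF indep, symmetric]) auto
  also have "(\<Inter>j\<in>J. Y j -` (space N - B) \<inter> space M) = space M - {\<omega> \<in> space M. \<exists>j\<in>J. Y j \<omega> \<in> B}"
    using J(2) measurable_space[OF Y] by auto
  also have "prob \<dots> = 1 - \<P>(\<omega> in M. \<exists>j\<in>J. Y j \<omega> \<in> B)"
  proof (rule prob_compl)
    have "{\<omega> \<in> space M. \<exists>j\<in>J. Y j \<omega> \<in> B} = (\<Union>j\<in>J. Y j -` B \<inter> space M)" by auto
    also have "\<dots> \<in> events" using J ev by (intro sets.finite_UN) auto
    finally show "{\<omega> \<in> space M. \<exists>j\<in>J. Y j \<omega> \<in> B} \<in> events" .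
  qed
  finally show ?thesis by simp
qed

theorem theorem3:
  fixes \<Omega> :: "'a measure" and s :: "nat \<Rightarrow> nat \<Rightarrow> 'a \<Rightarrow> real"
    and x :: "nat \<Rightarrow> real" and N M i :: nat and \<alpha> \<epsilon> :: real
  assumes "prob_space \<Omega>"
    and "0 < \<alpha>" "\<alpha> \<le> 0.05"
    and "M \<ge> 1"
    and "\<And>k j. k \<in> {1..N} \<Longrightarrow> j \<in> {1..M} \<Longrightarrow> s k j \<in> borel_measurable \<Omega>"
    and "prob_space.indep_vars \<Omega> (\<lambda>_. borel) (\<lambda>(k, j). s k j) ({1..N} \<times> {1..M})"
    and "\<And>k j t. k \<in> {1..N} \<Longrightarrow> j \<in> {1..M} \<Longrightarrow>
           char (distr \<Omega> borel (s k j)) t = complex_of_real (exp (- (\<bar>t\<bar> powr \<alpha>)))"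
    and "\<epsilon> > 0"
    and "i \<in> {1..N}"
    and "\<bar>x i\<bar> > \<epsilon>"
    and "(\<Sum>t\<in>{1..N} - {i}. \<bar>x t\<bar> powr \<alpha>) powr (1 / \<alpha>) > 0"
    and "((\<bar>x i\<bar> + \<epsilon>) / (\<Sum>t\<in>{1..N} - {i}. \<bar>x t\<bar> powr \<alpha>) powr (1 / \<alpha>))
           powr (\<alpha> / (1 - \<alpha>)) < 1 / 3"
  shows "measure \<Omega> {\<omega> \<in> space \<Omega>. \<bar>xhat_min x s N M i \<omega>\<bar> \<le> \<epsilon>}
    \<le> 1 - (1 - 3 / 4 * \<bar>(\<bar>x i\<bar> + \<epsilon>) / (\<Sum>t\<in>{1..N} - {i}. \<bar>x t\<bar> powr \<alpha>) powr (1 / \<alpha>)\<bar>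
                   powr (\<alpha> / (1 + \<alpha>))
            * (1 - \<bar>(\<bar>x i\<bar> - \<epsilon>) / (\<bar>x i\<bar> + \<epsilon>)\<bar> powr (\<alpha> / (1 - \<alpha>)))) ^ M"
proof -
  interpret prob_space \<Omega> by fact
  note \<alpha> = \<open>0 < \<alpha>\<close> \<open>\<alpha> \<le> 0.05\<close> and indep = assms(6) and char = assms(7)
    and \<epsilon> = \<open>\<epsilon> > 0\<close> \<open>\<bar>x i\<bar> > \<epsilon>\<close> and i = \<open>i \<in> {1..N}\<close>
  define K where "K = {1..N} - {i}"
  define \<theta> where "\<theta> = (\<Sum>k\<in>K. \<bar>x k\<bar> powr \<alpha>) powr (1 / \<alpha>)"
  have \<theta>: "0 < \<theta>" using assms(11) by (simp add: \<theta>_def K_def)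
  define a b where "a = \<bar>x i\<bar> - \<epsilon>" and "b = \<bar>x i\<bar> + \<epsilon>"
  define r where "r = b / \<theta>"
  have ab: "0 < a" "a < b" using \<epsilon> by (auto simp: a_def b_def)
  have r0: "0 < r" using ab \<theta> by (simp add: r_def)
  \<comment> \<open>If r were at least 1, so would be its power with exponent \<alpha> / (1 -
    \<alpha>), against the bound 1 / 3.\<close>
  have r1: "r < 1"
  proof (rule ccontr)
    assume "\<not> r < 1"
    then have "1 \<le> r powr (\<alpha> / (1 - \<alpha>))" using \<alpha> by (intro ge_one_powr_ge_zero) auto
    then show False using assms(12) by (simp add: r_def b_def \<theta>_def K_def)
  qed
  have \<theta>\<alpha>: "\<theta> powr \<alpha> = (\<Sum>k\<in>K. \<bar>x k\<bar> powr \<alpha>)"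
    using \<alpha> by (simp add: \<theta>_def powr_powr sum_nonneg)
  define c where "c = 3 / 4 * r powr (\<alpha> / (1 + \<alpha>)) * (1 - (a / b) powr (\<alpha> / (1 - \<alpha>)))"
  define Y where "Y j \<omega> = meas x s N j \<omega> / s i j \<omega>" for j \<omega>
  \<comment> \<open>The entries form one family indexed by pairs, and column \<open>j\<close>
    without row \<open>i\<close> is \<open>K \<times> {j}\<close>. Dividing by \<theta> normalises
    the weights, as \<theta>^\<alpha> is the sum of the |x_k|^\<alpha>.\<close>
  have "iid_stable_pair \<Omega> (s i j) (\<lambda>\<omega>. \<Sum>k\<in>K. x k / \<theta> * s k j \<omega>) \<alpha>" if j: "j \<in> {1..M}" for j
  proof -
    let ?s = "\<lambda>(k, j). s k j"
    have slice: "(\<Sum>k\<in>K \<times> {j}. f k) = (\<Sum>k\<in>K. f (k, j))" for f :: "nat \<times> nat \<Rightarrow> real"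
      by (rule sum.reindex_bij_witness[of _ "\<lambda>k. (k, j)" fst]) auto
    have sub: "insert (i, j) (K \<times> {j}) \<subseteq> {1..N} \<times> {1..M}" using i j by (auto simp: K_def)
    have "iid_stable_pair \<Omega> (?s (i, j)) (\<lambda>\<omega>. \<Sum>k\<in>K \<times> {j}. x (fst k) / \<theta> * ?s k \<omega>) \<alpha>"
    proof (rule iid_stable_pair_sum)
      show "indep_vars (\<lambda>_. borel) ?s (insert (i, j) (K \<times> {j}))"
        by (rule indep_vars_subset[OF indep sub])
      show "char (distr \<Omega> borel (?s k)) t = complex_of_real (exp (- (\<bar>t\<bar> powr \<alpha>)))"
        if "k \<in> insert (i, j) (K \<times> {j})" for k t
        using char[of "fst k" "snd k" t] sub that by (auto simp: case_prod_unfold)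
      have "(\<Sum>k\<in>K. \<bar>x k / \<theta>\<bar> powr \<alpha>) = (\<Sum>k\<in>K. \<bar>x k\<bar> powr \<alpha>) / \<theta> powr \<alpha>"
        using \<theta> by (simp add: sum_divide_distrib abs_divide powr_divide)
      also have "\<dots> = 1" using \<theta> by (simp add: \<theta>\<alpha>[symmetric])
      finally show "(\<Sum>k\<in>K \<times> {j}. \<bar>x (fst k) / \<theta>\<bar> powr \<alpha>) = 1"
        by (simp only: slice fst_conv)
    qed (use \<alpha> assms(1) in \<open>auto simp: K_def\<close>)
    then show ?thesis by (simp only: slice fst_conv prod.case)
  qed
  note pair = this
  have Y: "Y j \<omega> = (x i * s i j \<omega> + \<theta> * (\<Sum>k\<in>K. x k / \<theta> * s k j \<omega>)) / s i j \<omega>" for j \<omega>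
  proof -
    have "meas x s N j \<omega> = x i * s i j \<omega> + (\<Sum>k\<in>K. x k * s k j \<omega>)"
      unfolding meas_def K_def using i by (intro sum.remove) auto
    then show ?thesis using \<theta> by (simp add: Y_def sum_distrib_left)
  qed
  have Yprob: "\<P>(\<omega> in \<Omega>. Y j \<omega> \<in> {-\<epsilon>..\<epsilon>}) \<le> c" if j: "j \<in> {1..M}" for j
  proof -
    have "{\<omega> \<in> space \<Omega>. Y j \<omega> \<in> {-\<epsilon>..\<epsilon>}} = {\<omega> \<in> space \<Omega>. \<bar>Y j \<omega>\<bar> \<le> \<epsilon>}"
      by (auto simp: abs_le_iff)
    then have "\<P>(\<omega> in \<Omega>. Y j \<omega> \<in> {-\<epsilon>..\<epsilon>}) \<le> r powr \<alpha> / (2 * (1 - \<alpha>\<^sup>2)) * (1 - (a / b) powr \<alpha>)"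
      using iid_stable_pair.prob_shifted_ratio_le[OF pair[OF j] \<epsilon> \<theta>] r1
      by (simp add: Y r_def a_def b_def)
    \<comment> \<open>Three relaxations: 2 (1 - \<alpha>^2) \<ge> 4 / 3 for \<alpha> \<le> 0.05;
      lowering the exponent \<alpha> to \<alpha> / (1 + \<alpha>) enlarges the power of r < 1;
      raising \<alpha> to \<alpha> / (1 - \<alpha>) shrinks the power of a / b < 1, which is
      subtracted.\<close>
    also have "\<dots> \<le> c"
      unfolding c_def
    proof (rule mult_mono)
      have "\<alpha>\<^sup>2 \<le> 0.05\<^sup>2" using \<alpha> by (intro power_mono) auto
      then have "2 / 3 \<le> 1 - \<alpha>\<^sup>2" by (simp add: power2_eq_square)
      then have "r powr \<alpha> / (2 * (1 - \<alpha>\<^sup>2)) \<le> r powr \<alpha> / (4 / 3)"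
        by (intro divide_left_mono) auto
      also have "\<dots> = 3 / 4 * r powr \<alpha>" by simp
      also have "\<dots> \<le> 3 / 4 * r powr (\<alpha> / (1 + \<alpha>))"
        using \<alpha> r0 r1 by (intro mult_left_mono powr_mono') (auto simp: field_simps)
      finally show "r powr \<alpha> / (2 * (1 - \<alpha>\<^sup>2)) \<le> 3 / 4 * r powr (\<alpha> / (1 + \<alpha>))" .
      show "1 - (a / b) powr \<alpha> \<le> 1 - (a / b) powr (\<alpha> / (1 - \<alpha>))"
        using \<alpha> ab by (intro diff_left_mono powr_mono') (auto simp: field_simps)
      show "0 \<le> 1 - (a / b) powr \<alpha>"
        using \<alpha> ab by (auto intro!: powr_le1)
    qed simp
    finally show ?thesis .
  qed
  have c1: "c \<le> 1"
  proof -
    have "r powr (\<alpha> / (1 + \<alpha>)) \<le> 1" "(a / b) powr (\<alpha> / (1 - \<alpha>)) \<le> 1"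
      using \<alpha> r0 r1 ab by (auto intro!: powr_le1)
    then have "c \<le> (3 / 4 * 1) * 1"
      unfolding c_def by (intro mult_mono) auto
    then show ?thesis by simp
  qed
  \<comment> \<open>Each \<open>Y j\<close> is a measurable function of column \<open>j\<close>
    alone, and distinct columns are disjoint blocks of the independent family.\<close>
  have "indep_vars (\<lambda>_. borel) Y {1..M}"
  proof -
    let ?P = "\<lambda>j. PiM ({1..N} \<times> {j}) (\<lambda>_. borel :: real measure)"
    let ?g = "\<lambda>j f. (\<Sum>k=1..N. x k * f (k, j)) / f (i, j) :: real"
    have "indep_vars ?P (\<lambda>j \<omega>. restrict (\<lambda>p. (case p of (k, j) \<Rightarrow> s k j) \<omega>) ({1..N} \<times> {j})) {1..M}"
      by (rule indep_vars_restrict[OF indep]) (auto simp: disjoint_family_on_def)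
    then have "indep_vars (\<lambda>_. borel) (\<lambda>j \<omega>. ?g j (restrict (\<lambda>p. (case p of (k, j) \<Rightarrow> s k j) \<omega>) ({1..N} \<times> {j}))) {1..M}"
    proof (rule indep_vars_compose2)
      fix j
      have comp: "(\<lambda>f. f (k, j)) \<in> borel_measurable (?P j)" if "k \<in> {1..N}" for k
        by (rule measurable_component_singleton) (use that in auto)
      show "?g j \<in> borel_measurable (?P j)"
        using i by (intro borel_measurable_divide borel_measurable_sum borel_measurable_times comp) auto
    qed
    also have "?this \<longleftrightarrow> ?thesis"
      using i by (intro indep_vars_cong) (auto simp: Y_def meas_def fun_eq_iff)
    finally show ?thesis .
  qed
  then have bound: "\<P>(\<omega> in \<Omega>. \<exists>j\<in>{1..M}. Y j \<omega> \<in> {-\<epsilon>..\<epsilon>}) \<le> 1 - (1 - c) ^ card {1..M}"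
    using \<open>M \<ge> 1\<close> Yprob c1 by (intro prob_exists_le_of_indep) auto
  \<comment> \<open>The estimate is \<open>Y t\<close> for some \<open>t\<close> in
    \<open>{1..M}\<close>, so a small estimate means that some \<open>Y j\<close> is small, however
    ties are broken.\<close>
  have "measure \<Omega> {\<omega> \<in> space \<Omega>. \<bar>xhat_min x s N M i \<omega>\<bar> \<le> \<epsilon>}
      \<le> \<P>(\<omega> in \<Omega>. \<exists>j\<in>{1..M}. Y j \<omega> \<in> {-\<epsilon>..\<epsilon>})"
  proof (rule finite_measure_mono)
    show "{\<omega> \<in> space \<Omega>. \<bar>xhat_min x s N M i \<omega>\<bar> \<le> \<epsilon>} \<subseteq> {\<omega> \<in> space \<Omega>. \<exists>j\<in>{1..M}. Y j \<omega> \<in> {-\<epsilon>..\<epsilon>}}"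
    proof safe
      fix \<omega> assume le: "\<bar>xhat_min x s N M i \<omega>\<bar> \<le> \<epsilon>"
      define t where "t = arg_min_on (\<lambda>j. \<bar>meas x s N j \<omega> / s i j \<omega>\<bar>) {1..M}"
      have "t \<in> {1..M}" unfolding t_def using \<open>M \<ge> 1\<close> by (intro arg_min_if_finite) auto
      moreover have "\<bar>Y t \<omega>\<bar> \<le> \<epsilon>"
        using le unfolding xhat_min_def Let_def Y_def t_def .
      then have "Y t \<omega> \<in> {-\<epsilon>..\<epsilon>}" by (simp add: abs_le_iff)
      ultimately show "\<exists>j\<in>{1..M}. Y j \<omega> \<in> {-\<epsilon>..\<epsilon>}" by blast
    qed
    have "Y j \<in> borel_measurable \<Omega>" if "j \<in> {1..M}" for j
      using \<open>indep_vars (\<lambda>_. borel) Y {1..M}\<close> that by (auto simp: indep_vars_def)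
    then show "{\<omega> \<in> space \<Omega>. \<exists>j\<in>{1..M}. Y j \<omega> \<in> {-\<epsilon>..\<epsilon>}} \<in> events"
      by (intro sets.sets_Collect_finite_Ex) auto
  qed
  also note bound
  also have "1 - (1 - c) ^ card {1..M} = 1 - (1 - 3 / 4 * \<bar>r\<bar> powr (\<alpha> / (1 + \<alpha>))
      * (1 - \<bar>a / b\<bar> powr (\<alpha> / (1 - \<alpha>)))) ^ M"
    using r0 ab by (simp add: c_def)
  finally show ?thesis unfolding r_def a_def b_def \<theta>_def K_def .
qed

end
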